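(* Let $c>1$, $\alpha\in(0,2)\setminus\{1\}$, and let $\theta$ be a smooth admissable function with respect to $c$ and $\alpha$, with Fourier series $\theta(x)=\sum_{k=-\infty}^{\infty}c_k e^{ik\tilde c x}$, $\tilde c=\frac{2\pi\alpha}{\log c}$. Let $\phi_1$ be the measure on $(0,\infty)$ with $\phi_1(r,\infty)=r^{-\alpha}\theta(\log r)$ for all $r>0$, and let $$\psi(x)=\begin{cases}\displaystyle\int_{0+}^\infty (e^{ixy}-1)\,d\phi_1(y) & \text{if }\alpha\in(0,1),\\[2ex] \displaystyle\int_{0+}^\infty (e^{ixy}-1-ixy)\,d\phi_1(y) & \text{if }\alpha\in(1,2).\end{cases}$$ Then $$\psi(x)=-\sum_{k=-\infty}^{\infty}c_k\,\Gamma(ik\tilde c-\alpha+1)\,(-ix)^{\alpha-ik\tilde c}\qquad\text{for all }x\in\mathbb{R}.$$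
   Context: Given $c>1$ and $\alpha\in(0,2)$, a function $\theta:\mathbb{R}\to(0,\infty)$ is called admissable (with respect to $c$ and $\alpha$) if it is $\log(c^{1/\alpha})$-periodic and satisfies the growth restriction $\theta(y+\delta)\le e^{\alpha\delta}\theta(y)$ for all $y\in\mathbb{R}$, $\delta\ge 0$. It is called smooth admissable if in addition it is continuous on $\mathbb{R}$ and piecewise continuously differentiable. The function $\psi$ is the log-characteristic function of the semistable Lévy process with Lévy measure $\phi_1$ (concentrated on $(0,\infty)$) whose generator is $L_1f(x)=\int_{0+}^\infty(f(x-y)-f(x))\,d\phi_1(y)$ if $\alpha\in(0,1)$, respectively $L_3f(x)=\int_{0+}^\infty(f(x-y)-f(x)+yf'(x))\,d\phi_1(y)$ if $\alpha\in(1,2)$; i.e. $\widehat{Lf}=\psi\widehat f$ with $\widehat f(x)=\int_{\mathbb{R}}e^{ixy}f(y)\,dy$. Complex powers are taken with the principal branch, $w^z=\exp(z\log w)$, and $0^z=0$ for $\Re z>0$. *)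

theory Defs
  imports "HOL-Analysis.Analysis"
begin

definition admissible :: "real \<Rightarrow> real \<Rightarrow> (real \<Rightarrow> real) \<Rightarrow> bool" where
  "admissible c \<alpha> \<theta> \<longleftrightarrow>
     (\<forall>y. \<theta> y > 0) \<and>
     (\<forall>y. \<theta> (y + ln (c powr (1 / \<alpha>))) = \<theta> y) \<and>
     (\<forall>y. \<forall>\<delta>\<ge>0. \<theta> (y + \<delta>) \<le> exp (\<alpha> * \<delta>) * \<theta> y)"

text \<open>The library predicate allows finitely many breakpoints, so on the whole line it is imposed
  on every compact interval. It puts no condition on the derivative near a breakpoint; the
  usual convention that the derivative itself is piecewise continuous, i.e. has finite one-sided
  limits everywhere, is the second conjunct.\<close>

definition piecewise_C1 :: "(real \<Rightarrow> real) \<Rightarrow> bool" where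
  "piecewise_C1 f \<longleftrightarrow>
     (\<forall>a b. f piecewise_C1_differentiable_on {a..b}) \<and>
     (\<forall>t. (\<exists>l. (deriv f \<longlongrightarrow> l) (at_left t)) \<and> (\<exists>r. (deriv f \<longlongrightarrow> r) (at_right t)))"

definition smooth_admissible :: "real \<Rightarrow> real \<Rightarrow> (real \<Rightarrow> real) \<Rightarrow> bool" where
  "smooth_admissible c \<alpha> \<theta> \<longleftrightarrow>
     admissible c \<alpha> \<theta> \<and> continuous_on UNIV \<theta> \<and> piecewise_C1 \<theta>"

definition freq :: "real \<Rightarrow> real \<Rightarrow> real" where
  "freq c \<alpha> = 2 * pi * \<alpha> / ln c"

text \<open>The \<open>k\<close>-th Fourier coefficient of a \<open>2\<pi>/\<omega>\<close>-periodic function, i.e. the coefficient of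
  \<open>exp (i k \<omega> x)\<close>.\<close>

definition fourier_coeff :: "real \<Rightarrow> (real \<Rightarrow> real) \<Rightarrow> int \<Rightarrow> complex" where
  "fourier_coeff \<omega> f k =
     of_real (\<omega> / (2 * pi)) *
     integral {0..2 * pi / \<omega>} (\<lambda>x. of_real (f x) * exp (- \<i> * of_int k * of_real (\<omega> * x)))"

text \<open>The tail condition determines the measure uniquely, because the intervals \<open>{r<..}\<close> with
  \<open>r > 0\<close> generate the Borel sets of \<open>{0<..}\<close> and have finite measure.\<close>

definition is_levy_measure :: "real \<Rightarrow> (real \<Rightarrow> real) \<Rightarrow> real measure \<Rightarrow> bool" where
  "is_levy_measure \<alpha> \<theta> \<phi> \<longleftrightarrow>
     sets \<phi> = sets (restrict_space borel {0<..}) \<and>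
     (\<forall>r>0. emeasure \<phi> {r<..} = ennreal (r powr (- \<alpha>) * \<theta> (ln r)))"

definition log_char :: "real \<Rightarrow> real measure \<Rightarrow> real \<Rightarrow> complex" where
  "log_char \<alpha> \<phi> x =
     (if \<alpha> < 1
      then \<integral>y. exp (\<i> * of_real (x * y)) - 1 \<partial>\<phi>
      else \<integral>y. exp (\<i> * of_real (x * y)) - 1 - \<i> * of_real (x * y) \<partial>\<phi>)"

end

theory Submission
  imports Defs
begin

text \<open>
  For \<open>Re z > 0\<close> put \<open>E z r = exp (- z r)\<close> if \<open>\<alpha> < 1\<close> and \<open>E z r = exp (- z r) - 1\<close> if \<open>\<alpha> > 1\<close>.
  By Fubini, the integral against \<open>\<phi>\<close> of the compensated exponential is
  \<open>- z \<integral> E z r r\<^sup>-\<^sup>\<alpha> \<theta> (ln r) dr\<close>. Expanding \<open>\<theta>\<close> in its Fourier series turns this into a sum of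
  Mellin transforms of \<open>E z\<close> at the points \<open>s k = 1 - \<alpha> + i k w\<close>, which are \<open>Gamma (s k) z powr (- s k)\<close>.
  The identity on the imaginary axis follows by letting \<open>z = t - i x\<close> with \<open>t\<close> decreasing to 0.
  There the factor \<open>z powr (- s k)\<close> grows like \<open>exp (\<pi> |k| w / 2)\<close> for \<open>k\<close> of one sign and
  cancels the exponential decay of \<open>Gamma (s k)\<close>, so the remaining convergence rests on
  two facts: \<open>|Gamma (\<sigma> + i t)| exp (\<pi> |t| / 2)\<close> is \<open>O (|t|\<^sup>b)\<close> for some \<open>b < 1/2\<close> when \<open>\<sigma> < 1\<close>, and
  \<open>\<Sum> k\<^sup>2 |c k|\<^sup>2\<close> is finite because \<open>\<theta>\<close> is Lipschitz.
\<close>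

subsection \<open>The Gamma function on vertical lines\<close>

text \<open>The threshold 1/2 is where the two facts can be paired: the sum of
  \<open>|k| powr b * |c k|\<close> is controlled by the sums of \<open>k^2 * |c k|^2\<close> and of
  \<open>|k| powr (2 * b - 2)\<close>, and the latter converges exactly for b < 1/2. The true order
  of Gamma on the line of real part 1 - \<alpha>, apart from the exponential factor, is
  \<open>|t| powr (1/2 - \<alpha>)\<close>, so every \<alpha> > 0 leaves room. Off the axis the
  modulus of r to the power \<open>s k - 1\<close> is the same for all k, and absolute convergence
  of the Fourier series is enough to integrate termwise. In the limit towards the axis the two sides
  are treated separately: the series by the Weierstrass M-test, the integral against \<phi> by
  dominated convergence, where the integrand at z = 1 serves, up to a constant, as the dominating
  function for all z of a bounded part of the closed half-plane.\<close>

text \<open>The Weierstrass product shows that \<open>|Gamma (u + i t)| / Gamma u\<close> is increasing and log-concave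
  in \<open>u > 0\<close>. Interpolating between the explicit moduli at \<open>u = 1\<close> and \<open>u = 3/2\<close> bounds it from
  below, and the reflection formula converts this into an upper bound for real part below 1.\<close>

lemma convex_on_ln_one_plus_inverse_square:
  fixes t :: real
  shows "convex_on {0<..} (\<lambda>u. ln (1 + t\<^sup>2 / u\<^sup>2))"
proof -
  have pos: "u\<^sup>2 + t\<^sup>2 > 0" if "u > 0" for u :: real
    using that by (simp add: sum_power2_gt_zero_iff)
  have eq: "ln (u\<^sup>2 + t\<^sup>2) - 2 * ln u = ln (1 + t\<^sup>2 / u\<^sup>2)" if "u \<in> {0<..}" for u :: real
  proof -
    have "1 + t\<^sup>2 / u\<^sup>2 = (u\<^sup>2 + t\<^sup>2) / u\<^sup>2" using that by (simp add: field_simps)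
    then show ?thesis using that pos[of u] by (simp add: ln_div ln_realpow)
  qed
  show ?thesis
  proof (rule f''_ge0_imp_convex)
    show "((\<lambda>u. ln (1 + t\<^sup>2 / u\<^sup>2)) has_real_derivative (2 * u / (u\<^sup>2 + t\<^sup>2) - 2 / u)) (at u)"
      if "u \<in> {0<..}" for u
    proof (rule has_field_derivative_transform_within_open[OF _ open_greaterThan that eq])
      show "((\<lambda>u. ln (u\<^sup>2 + t\<^sup>2) - 2 * ln u) has_real_derivative
             (2 * u / (u\<^sup>2 + t\<^sup>2) - 2 / u)) (at u)"
        using that pos[of u] by (auto intro!: derivative_eq_intros simp: field_simps)
    qed
    show "((\<lambda>u. 2 * u / (u\<^sup>2 + t\<^sup>2) - 2 / u) has_real_derivative
             ((2 * (u\<^sup>2 + t\<^sup>2) - 2 * u * (2 * u)) / (u\<^sup>2 + t\<^sup>2)\<^sup>2 + 2 / u\<^sup>2)) (at u)" if "u \<in> {0<..}" for u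
      using that pos[of u]
      by (auto intro!: derivative_eq_intros simp: field_simps power2_eq_square power4_eq_xxxx)
    show "(2 * (u\<^sup>2 + t\<^sup>2) - 2 * u * (2 * u)) / (u\<^sup>2 + t\<^sup>2)\<^sup>2 + 2 / u\<^sup>2 \<ge> 0" if "u \<in> {0<..}" for u
    proof -
      have "(2 * (u\<^sup>2 + t\<^sup>2) - 2 * u * (2 * u)) / (u\<^sup>2 + t\<^sup>2)\<^sup>2 + 2 / u\<^sup>2
          = (6 * t\<^sup>2 * u\<^sup>2 + 2 * (t\<^sup>2)\<^sup>2) / ((u\<^sup>2 + t\<^sup>2)\<^sup>2 * u\<^sup>2)"
        using that pos[of u]
        by (simp add: divide_simps) (auto simp: algebra_simps power2_eq_square power4_eq_xxxx)
      then show ?thesis by simp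
    qed
  qed auto
qed

lemma Gamma_nonzero_Re_pos:
  fixes z :: complex
  assumes "Re z > 0"
  shows "Gamma z \<noteq> 0"
  using assms by (auto simp: Gamma_eq_zero_iff elim!: nonpos_Ints_cases)

text \<open>In the quotient of the \<open>Gamma_series\<close> moduli at u + it and at u the factors
  n! and n to the power u cancel, leaving the product of \<open>(u + j) / |u + j + i t|\<close>.
  Writing it as an exponential of a sum lets monotonicity and concavity in u be checked summand by
  summand.\<close>

lemma norm_Gamma_ratio_LIMSEQ:
  fixes u t :: real
  assumes "u > 0"
  shows "(\<lambda>n. exp (- (\<Sum>j\<le>n. ln (1 + t\<^sup>2 / (u + real j)\<^sup>2)) / 2))
           \<longlonglongrightarrow> norm (Gamma (Complex u t)) / Gamma u"
proof -
  have "Gamma u \<noteq> 0"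
    using Gamma_real_pos[OF assms] by linarith
  have "(\<lambda>n. norm (Gamma_series (Complex u t) n) / Gamma_series u n)
          \<longlonglongrightarrow> norm (Gamma (Complex u t)) / Gamma u"
    using assms by (intro tendsto_intros Gamma_series_LIMSEQ) (use \<open>Gamma u \<noteq> 0\<close> in auto)
  moreover have "norm (Gamma_series (Complex u t) n) / Gamma_series u n
      = exp (- (\<Sum>j\<le>n. ln (1 + t\<^sup>2 / (u + real j)\<^sup>2)) / 2)" for n
  proof -
    have *: "(u + real j) / cmod (Complex u t + of_nat j) = exp (- ln (1 + t\<^sup>2 / (u + real j)\<^sup>2) / 2)" for j
    proof -
      have p: "u + real j > 0" using assms by simp
      have "exp (- ln (1 + t\<^sup>2 / (u + real j)\<^sup>2) / 2) = 1 / sqrt (1 + t\<^sup>2 / (u + real j)\<^sup>2)"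
      proof -
        have "1 + t\<^sup>2 / (u + real j)\<^sup>2 > 0" by (simp add: add_pos_nonneg)
        then show ?thesis
          by (simp add: powr_half_sqrt[symmetric] powr_def exp_minus field_simps)
      qed
      also have "sqrt (1 + t\<^sup>2 / (u + real j)\<^sup>2) = cmod (Complex u t + of_nat j) / (u + real j)"
      proof -
        have "1 + t\<^sup>2 / (u + real j)\<^sup>2 = ((u + real j)\<^sup>2 + t\<^sup>2) / (u + real j)\<^sup>2"
          using p by (simp add: field_simps)
        then show ?thesis
          using p by (simp add: real_sqrt_divide cmod_def)
      qed
      finally show ?thesis by simp
    qed
    have "norm (Gamma_series (Complex u t) n) / Gamma_series u n
       = (\<Prod>j\<le>n. u + real j) / (\<Prod>j\<le>n. cmod (Complex u t + of_nat j))"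
      by (simp add: Gamma_series_def norm_divide norm_mult pochhammer_prod atLeast0AtMost
            prod_norm [symmetric] lessThan_Suc_atMost atLeast0LessThan)
    also have "\<dots> = (\<Prod>j\<le>n. exp (- ln (1 + t\<^sup>2 / (u + real j)\<^sup>2) / 2))"
      by (simp add: prod_dividef [symmetric] *)
    also have "\<dots> = exp (- (\<Sum>j\<le>n. ln (1 + t\<^sup>2 / (u + real j)\<^sup>2)) / 2)"
      by (simp add: exp_sum [symmetric] sum_negf sum_divide_distrib)
    finally show ?thesis .
  qed
  ultimately show ?thesis by simp
qed

lemma norm_Gamma_ratio_mono:
  fixes x y t :: real
  assumes "0 < x" "x \<le> y"
  shows "norm (Gamma (Complex x t)) / Gamma x \<le> norm (Gamma (Complex y t)) / Gamma y"
proof (rule LIMSEQ_le[OF norm_Gamma_ratio_LIMSEQ norm_Gamma_ratio_LIMSEQ])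
  have "ln (1 + t\<^sup>2 / (y + real j)\<^sup>2) \<le> ln (1 + t\<^sup>2 / (x + real j)\<^sup>2)" for j
    using assms by (intro ln_mono add_left_mono divide_left_mono power_mono mult_pos_pos)
      (auto simp: add_pos_nonneg)
  then show "\<exists>N. \<forall>n\<ge>N. exp (- (\<Sum>j\<le>n. ln (1 + t\<^sup>2 / (x + real j)\<^sup>2)) / 2)
       \<le> exp (- (\<Sum>j\<le>n. ln (1 + t\<^sup>2 / (y + real j)\<^sup>2)) / 2)"
    by (auto intro!: sum_mono)
qed (use assms in auto)

lemma norm_Gamma_ratio_log_concave:
  fixes x y t l :: real
  assumes "0 < x" "0 < y" "0 \<le> l" "l \<le> 1"
  shows "(norm (Gamma (Complex x t)) / Gamma x) powr (1 - l) * (norm (Gamma (Complex y t)) / Gamma y) powr l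
       \<le> norm (Gamma (Complex ((1 - l) * x + l * y) t)) / Gamma ((1 - l) * x + l * y)"
    (is "?L \<le> _")
proof (rule LIMSEQ_le)
  let ?m = "(1 - l) * x + l * y"
  let ?q = "\<lambda>u n. \<Sum>j\<le>n. ln (1 + t\<^sup>2 / (u + real j)\<^sup>2)"
  have "?m > 0"
    using assms by (cases "l = 0") (auto intro!: add_nonneg_pos)
  then show "(\<lambda>n. exp (- ?q ?m n / 2)) \<longlonglongrightarrow> norm (Gamma (Complex ?m t)) / Gamma ?m"
    by (rule norm_Gamma_ratio_LIMSEQ)
  \<comment> \<open>The limits must be nonzero for \<open>tendsto_powr\<close> to pass them through
    the real powers.\<close>
  have nz: "norm (Gamma (Complex u t)) / Gamma u \<noteq> 0" if "u > 0" for u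
    using Gamma_nonzero_Re_pos[of "Complex u t"] Gamma_nonzero_Re_pos[of "of_real u"] that
    by (simp add: Gamma_complex_of_real)
  show "(\<lambda>n. exp (- ?q x n / 2) powr (1 - l) * exp (- ?q y n / 2) powr l) \<longlonglongrightarrow> ?L"
    using assms by (intro tendsto_mult tendsto_powr tendsto_const norm_Gamma_ratio_LIMSEQ nz)
  have "?q ?m n \<le> (1 - l) * ?q x n + l * ?q y n" for n
  proof -
    have "ln (1 + t\<^sup>2 / (?m + real j)\<^sup>2)
        \<le> (1 - l) * ln (1 + t\<^sup>2 / (x + real j)\<^sup>2) + l * ln (1 + t\<^sup>2 / (y + real j)\<^sup>2)" for j
    proof -
      have "?m + real j = (1 - l) *\<^sub>R (x + real j) + l *\<^sub>R (y + real j)"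
        by (simp add: algebra_simps)
      then show ?thesis
        using convex_onD[OF convex_on_ln_one_plus_inverse_square, of l "x + real j" "y + real j"] assms
        by simp
    qed
    then show ?thesis
      by (simp add: sum_distrib_left sum.distrib[symmetric] sum_mono)
  qed
  then show "\<exists>N. \<forall>n\<ge>N. exp (- ?q x n / 2) powr (1 - l) * exp (- ?q y n / 2) powr l \<le> exp (- ?q ?m n / 2)"
    by (auto simp: powr_def exp_add[symmetric] algebra_simps simp flip: add_divide_distrib)
qed

text \<open>The reflection formula at it, after Gamma (1 + it) = it Gamma (it); conjugation
  identifies the moduli at 1 + it and 1 - it.\<close>

lemma norm_Gamma_one_plus_ii:
  fixes t :: real
  assumes "t > 0"
  shows "norm (Gamma (Complex 1 t)) ^ 2 = pi * t / sinh (pi * t)"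
proof -
  have r: "Gamma (\<i> * t) * Gamma (1 - \<i> * t) = of_real pi / sin (of_real pi * (\<i> * t))"
    by (rule Gamma_reflection_complex)
  have 1: "Gamma (Complex 1 t) = \<i> * t * Gamma (\<i> * t)"
    using Gamma_plus1[of "\<i> * t"] assms
    by (simp add: Complex_eq add.commute nonpos_Ints_def complex_eq_iff)
  have 2: "norm (Gamma (1 - \<i> * t)) = norm (Gamma (Complex 1 t))"
    using cnj_Gamma[of "Complex 1 t"] by (simp add: Complex_eq) (metis complex_mod_cnj)
  have 3: "sin (of_real pi * (\<i> * t)) = \<i> * of_real (sinh (pi * t))"
    using sinh_conv_sin[of "complex_of_real (pi * t)"] 
    by (simp add: sinh_field_def sin_times_pi_eq_0 field_simps complex_eq_iff Re_sin Im_sin sinh_def)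
  have "norm (Gamma (Complex 1 t)) ^ 2 = norm (\<i> * t * (Gamma (\<i> * t) * Gamma (1 - \<i> * t)))"
    unfolding power2_eq_square norm_mult 2 using 1 by (simp add: norm_mult)
  also have "\<dots> = pi * t / sinh (pi * t)"
    unfolding r 3 using assms by (simp add: norm_mult norm_divide)
  finally show ?thesis .
qed

lemma norm_Gamma_one_half_plus_ii:
  fixes t :: real
  shows "norm (Gamma (Complex (1 / 2) t)) ^ 2 = pi / cosh (pi * t)"
proof -
  let ?s = "Complex (1 / 2) t"
  have r: "Gamma ?s * Gamma (1 - ?s) = of_real pi / sin (of_real pi * ?s)"
    by (rule Gamma_reflection_complex)
  have 2: "norm (Gamma (1 - ?s)) = norm (Gamma ?s)"
  proof -
    have "1 - ?s = cnj ?s" by (simp add: complex_eq_iff)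
    then show ?thesis by (metis cnj_Gamma complex_mod_cnj)
  qed
  have 3: "sin (of_real pi * ?s) = of_real (cosh (pi * t))"
    by (simp add: complex_eq_iff Re_sin Im_sin cosh_def)
  have "norm (Gamma ?s) ^ 2 = norm (Gamma ?s * Gamma (1 - ?s))"
    unfolding power2_eq_square norm_mult 2 by simp
  also have "\<dots> = pi / cosh (pi * t)"
    unfolding r 3 by (simp add: norm_divide)
  finally show ?thesis .
qed

lemma norm_Gamma_three_halves_ge:
  fixes t :: real
  assumes "t > 0"
  shows "sqrt pi * t * exp (- pi * t / 2) \<le> norm (Gamma (Complex (3 / 2) t))"
proof -
  let ?s = "Complex (1 / 2) t"
  have 1: "Gamma (Complex (3 / 2) t) = ?s * Gamma ?s"
  proof -
    have "?s \<notin> \<int>\<^sub>\<le>\<^sub>0" using assms by (auto elim!: nonpos_Ints_cases simp: complex_eq_iff)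
    moreover have "?s + 1 = Complex (3 / 2) t" by (simp add: complex_eq_iff)
    ultimately show ?thesis using Gamma_plus1[of ?s] by simp
  qed
  have "norm ?s \<ge> t"
    using abs_Im_le_cmod[of ?s] assms by simp
  moreover have "norm (Gamma ?s) \<ge> sqrt pi * exp (- pi * t / 2)"
  proof (rule power2_le_imp_le)
    have "cosh (pi * t) \<le> exp (pi * t)"
      using assms by (simp add: cosh_def)
    then have "pi / cosh (pi * t) \<ge> pi / exp (pi * t)"
      by (intro divide_left_mono) (auto simp: cosh_real_pos)
    also have "pi / exp (pi * t) = (sqrt pi * exp (- pi * t / 2))\<^sup>2"
      by (simp add: power_mult_distrib exp_minus exp_double[symmetric] field_simps)
    finally show "(sqrt pi * exp (- pi * t / 2))\<^sup>2 \<le> (norm (Gamma ?s))\<^sup>2"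
      by (simp add: norm_Gamma_one_half_plus_ii)
  qed auto
  ultimately have "t * (sqrt pi * exp (- pi * t / 2)) \<le> norm ?s * norm (Gamma ?s)"
    using assms by (intro mult_mono) auto
  then show ?thesis by (simp add: 1 norm_mult mult_ac)
qed

lemma norm_Gamma_one_ge:
  fixes t :: real
  assumes "t > 0"
  shows "sqrt (2 * pi) * t powr (1/2) * exp (- pi * t / 2) \<le> norm (Gamma (Complex 1 t))"
proof (rule power2_le_imp_le)
  have "sinh (pi * t) \<le> exp (pi * t) / 2" "sinh (pi * t) > 0"
    using assms by (simp_all add: sinh_def)
  then have "pi * t / sinh (pi * t) \<ge> pi * t / (exp (pi * t) / 2)"
    using assms by (intro divide_left_mono) auto
  also have "pi * t / (exp (pi * t) / 2) = (sqrt (2 * pi) * t powr (1/2) * exp (- pi * t / 2))\<^sup>2"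
    using assms by (simp add: power_mult_distrib exp_minus exp_double[symmetric] field_simps powr_half_sqrt)
  finally show "(sqrt (2 * pi) * t powr (1/2) * exp (- pi * t / 2))\<^sup>2 \<le> (norm (Gamma (Complex 1 t)))\<^sup>2"
    by (simp add: norm_Gamma_one_plus_ii assms)
qed auto

text \<open>From u = 3/2 on, monotonicity of the ratio gives the first power of t, that is b = 0.
  Below 3/2, interpolation gives t to the power (1 - l)/2 + l, so b = (1 - l)/2 = 3/2 - u, which is
  below 1/2 precisely because u > 1.\<close>

lemma norm_Gamma_vertical_lower_bound:
  fixes u :: real
  assumes "u > 1"
  obtains C b where "C > 0" "0 \<le> b" "b < 1 / 2"
    "\<And>t. t > 0 \<Longrightarrow> C * t powr (1 - b) * exp (- pi * t / 2) \<le> norm (Gamma (Complex u t))"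
proof -
  define g where "g = Gamma (3 / 2 :: real)"
  define h where "h = Gamma u"
  have pos: "h > 0" "g > 0"
    using assms unfolding g_def h_def by (auto intro: Gamma_real_pos)
  show thesis
  proof (cases "u \<ge> 3 / 2")
    case True
    let ?C = "h / g * sqrt pi"
    show ?thesis
    proof (rule that[of ?C 0])
      fix t :: real assume t: "t > 0"
      have "?C * t powr (1 - 0) * exp (- pi * t / 2)
          = h * ((sqrt pi * t * exp (- pi * t / 2)) / g)" using t by simp
      also have "\<dots> \<le> h * (norm (Gamma (Complex (3 / 2) t)) / g)"
        using pos norm_Gamma_three_halves_ge[OF t] by (intro mult_left_mono divide_right_mono) auto
      also have "\<dots> \<le> h * (norm (Gamma (Complex u t)) / h)"
        using pos True by (intro mult_left_mono) (auto simp: g_def h_def intro!: norm_Gamma_ratio_mono)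
      finally show "?C * t powr (1 - 0) * exp (- pi * t / 2) \<le> norm (Gamma (Complex u t))"
        using pos by simp
    qed (use pos in auto)
  next
    case False
    \<comment> \<open>The weight that places u between the nodes 1 and 3/2.\<close>
    define l where "l = 2 * (u - 1)"
    have l: "0 < l" "l < 1" "(1 - l) * 1 + l * (3 / 2) = u"
      using False assms by (auto simp: l_def algebra_simps)
    let ?C = "h * (sqrt (2 * pi)) powr (1 - l) * (sqrt pi / g) powr l"
    show ?thesis
    proof (rule that[of ?C "(1 - l) / 2"])
      show "?C > 0" using pos by (intro mult_pos_pos) auto
      fix t :: real assume t: "t > 0"
      have "t powr (1 - (1 - l) / 2) * exp (- pi * t / 2)
          = (t powr (1/2) * exp (- pi * t / 2)) powr (1 - l) * (t * exp (- pi * t / 2)) powr l"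
      proof -
        have "exp (- pi * t / 2) powr (1 - l) * exp (- pi * t / 2) powr l = exp (- pi * t / 2)"
          by (simp add: powr_add[symmetric])
        moreover have "t powr (1 - (1 - l) / 2) = (t powr (1/2)) powr (1 - l) * t powr l"
          using t by (simp add: powr_powr powr_add[symmetric] field_simps)
        ultimately show ?thesis using t by (simp add: powr_mult mult_ac)
      qed
      then have "?C * t powr (1 - (1 - l) / 2) * exp (- pi * t / 2)
         = h * ((sqrt (2 * pi) * t powr (1/2) * exp (- pi * t / 2)) powr (1 - l)
           * ((sqrt pi * t * exp (- pi * t / 2)) / g) powr l)"
        using t pos by (simp add: powr_mult powr_divide mult_ac)
      also have "\<dots> \<le> h * ((norm (Gamma (Complex 1 t)) / Gamma 1) powr (1 - l)
          * (norm (Gamma (Complex (3/2) t)) / g) powr l)"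
        using pos norm_Gamma_three_halves_ge[OF t] norm_Gamma_one_ge[OF t] l t
        by (intro mult_left_mono mult_mono powr_mono2 divide_right_mono) auto
      also have "\<dots> \<le> h * (norm (Gamma (Complex u t)) / h)"
        using norm_Gamma_ratio_log_concave[of 1 "3/2" l t] l pos by (intro mult_left_mono) (auto simp: g_def h_def)
      finally show "?C * t powr (1 - (1 - l) / 2) * exp (- pi * t / 2) \<le> norm (Gamma (Complex u t))"
        using pos by simp
    qed (use l in auto)
  qed
qed

text \<open>The squared modulus of sin z is the sum of the squares of sin (Re z) and sinh (Im
  z).\<close>

lemma norm_sin_ge_abs_sinh_Im:
  fixes z :: complex
  shows "\<bar>sinh (Im z)\<bar> \<le> norm (sin z)"
proof (rule power2_le_imp_le)
  have "(norm (sin z))\<^sup>2 = (sin (Re z))\<^sup>2 * (cosh (Im z))\<^sup>2 + (cos (Re z))\<^sup>2 * (sinh (Im z))\<^sup>2"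
    unfolding cmod_power2 Re_sin Im_sin power_mult_distrib
    by (simp add: cosh_field_def sinh_field_def power_mult_distrib power_divide)
  also have "\<dots> = (sin (Re z))\<^sup>2 + (sinh (Im z))\<^sup>2"
    unfolding cos_squared_eq cosh_square_eq by (simp add: algebra_simps)
  finally show "\<bar>sinh (Im z)\<bar>\<^sup>2 \<le> (norm (sin z))\<^sup>2" by simp
qed auto

text \<open>Multiplying the reflection formula by 1 - s gives |Gamma s| |Gamma (2 - s)| = |1 - s| pi
  / |sin (pi s)|. The passage from 1 - s to 2 - s brings the real part above 1, where the lower
  bound applies; then \<open>t * exp (- pi t)\<close> divided by
  \<open>t powr (1 - b) * exp (- pi t / 2)\<close> is the claimed order.\<close>

lemma norm_Gamma_vertical_upper_bound:
  fixes \<sigma> t0 :: real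
  assumes "\<sigma> < 1" "t0 > 0"
  obtains C b where "C > 0" "0 \<le> b" "b < 1 / 2"
    "\<And>t. \<bar>t\<bar> \<ge> t0 \<Longrightarrow> norm (Gamma (Complex \<sigma> t)) \<le> C * \<bar>t\<bar> powr b * exp (- pi * \<bar>t\<bar> / 2)"
proof -
  obtain C b where C: "C > 0" "0 \<le> b" "b < 1 / 2"
    and low: "\<And>t. t > 0 \<Longrightarrow> C * t powr (1 - b) * exp (- pi * t / 2) \<le> norm (Gamma (Complex (2 - \<sigma>) t))"
    using norm_Gamma_vertical_lower_bound[of "2 - \<sigma>"] assms by auto
  \<comment> \<open>\<open>A\<close> and \<open>B\<close> make |1 - s| \<le> A t and sinh (pi t)
    \<ge> B exp (pi t) hold for all t \<ge> t0. The cutoff t0 is essential to \<open>B\<close>,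
    since sinh vanishes at 0.\<close>
  define A where "A = (1 - \<sigma>) / t0 + 1"
  define B where "B = (1 - exp (- 2 * pi * t0)) / 2"
  have "A > 0" "B > 0" using assms by (auto simp: A_def B_def add_pos_pos)
  have main: "norm (Gamma (Complex \<sigma> t)) \<le> (A * pi / (B * C)) * t powr b * exp (- pi * t / 2)"
    if t: "t \<ge> t0" for t
  proof -
    let ?s = "Complex \<sigma> t"
    have "t > 0" using t assms by simp
    have 1: "norm (1 - ?s) \<le> A * t"
    proof -
      have "norm (1 - ?s) \<le> \<bar>1 - \<sigma>\<bar> + \<bar>t\<bar>"
        using cmod_le[of "1 - ?s"] by simp
      also have "\<dots> \<le> (1 - \<sigma>) * (t / t0) + t"
        using mult_left_mono[of 1 "t / t0" "1 - \<sigma>"] t assms by simp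
      finally show ?thesis by (simp add: A_def algebra_simps)
    qed
    have 2: "norm (sin (of_real pi * ?s)) \<ge> B * exp (pi * t)"
    proof -
      have "B * exp (pi * t) \<le> (1 - exp (- 2 * pi * t)) / 2 * exp (pi * t)"
        unfolding B_def using t by (intro mult_right_mono divide_right_mono diff_left_mono) auto
      also have "\<dots> = sinh (pi * t)"
        by (simp add: sinh_field_def left_diff_distrib diff_divide_distrib exp_add[symmetric])
      also have "\<dots> \<le> norm (sin (of_real pi * ?s))"
        using norm_sin_ge_abs_sinh_Im[of "of_real pi * ?s"] by simp
      finally show ?thesis .
    qed
    have n2: "norm (Gamma (2 - ?s)) = norm (Gamma (Complex (2 - \<sigma>) t))"
    proof -
      have "2 - ?s = cnj (Complex (2 - \<sigma>) t)" by (simp add: complex_eq_iff)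
      then show ?thesis by (metis cnj_Gamma complex_mod_cnj)
    qed
    have 3: "Gamma (2 - ?s) = (1 - ?s) * Gamma (1 - ?s)"
    proof -
      have "1 - ?s \<notin> \<int>\<^sub>\<le>\<^sub>0"
        using \<open>t > 0\<close> by (auto elim!: nonpos_Ints_cases simp: complex_eq_iff)
      from Gamma_plus1[OF this] show ?thesis by (simp add: algebra_simps)
    qed
    define D where "D = C * t powr (1 - b) * exp (- pi * t / 2)"
    have D: "0 < D" "D \<le> norm (Gamma (2 - ?s))"
      unfolding D_def n2 using low[OF \<open>t > 0\<close>] \<open>t > 0\<close> C by auto
    have nz: "norm (sin (of_real pi * ?s)) > 0"
      by (rule less_le_trans[OF _ 2]) (use \<open>B > 0\<close> in auto)
    have "norm (Gamma ?s) * norm (Gamma (2 - ?s)) = norm (1 - ?s) * norm (Gamma ?s * Gamma (1 - ?s))"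
      by (simp add: 3 norm_mult)
    also have "\<dots> = norm (1 - ?s) * (pi / norm (sin (of_real pi * ?s)))"
      by (simp add: Gamma_reflection_complex norm_divide)
    also have "\<dots> \<le> (A * t) * (pi / (B * exp (pi * t)))"
      using 1 2 nz \<open>B > 0\<close> \<open>A > 0\<close> \<open>t > 0\<close> by (intro mult_mono divide_left_mono mult_pos_pos) auto
    finally have "norm (Gamma ?s) * norm (Gamma (2 - ?s)) \<le> (A * t) * (pi / (B * exp (pi * t)))" .
    moreover have "norm (Gamma ?s) * D \<le> norm (Gamma ?s) * norm (Gamma (2 - ?s))"
      using D by (intro mult_left_mono) auto
    ultimately have "norm (Gamma ?s) \<le> (A * t) * (pi / (B * exp (pi * t))) / D"
      by (intro mult_imp_le_div_pos) (use D in auto)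
    also have "\<dots> = (A * pi / (B * C)) * t powr b * exp (- pi * t / 2)"
    proof -
      have "t powr b = t / t powr (1 - b)"
        using \<open>t > 0\<close> by (simp add: powr_diff)
      moreover have "exp (pi * t) = exp (pi * t / 2) * exp (pi * t / 2)" by (simp flip: exp_add)
      ultimately show ?thesis
        using \<open>t > 0\<close> \<open>B > 0\<close> C unfolding D_def
        by (simp add: exp_minus field_simps)
    qed
    finally show ?thesis .
  qed
  show ?thesis
  proof (rule that[of "A * pi / (B * C)" b])
    fix t :: real assume t: "t0 \<le> \<bar>t\<bar>"
    have "norm (Gamma (Complex \<sigma> t)) = norm (Gamma (Complex \<sigma> \<bar>t\<bar>))"
    proof (cases "t \<ge> 0")
      case False
      then have "Complex \<sigma> \<bar>t\<bar> = cnj (Complex \<sigma> t)" by (simp add: complex_eq_iff)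
      then show ?thesis by (metis cnj_Gamma complex_mod_cnj)
    qed auto
    then show "norm (Gamma (Complex \<sigma> t)) \<le> A * pi / (B * C) * \<bar>t\<bar> powr b * exp (- pi * \<bar>t\<bar> / 2)"
      using main[OF t] by simp
  qed (use C \<open>A > 0\<close> \<open>B > 0\<close> in auto)
qed

subsection \<open>Fourier series of Lipschitz functions\<close>

text \<open>A finite measure, so that bounded Borel functions are integrable. The quotient in
  Chernoff's argument is only bounded and measurable, which is why coefficients are taken as
  Lebesgue integrals here.\<close>

definition period_measure :: "real \<Rightarrow> real measure" where
  "period_measure w = restrict_space lborel {0..2 * pi / w}"

definition cfourier :: "real \<Rightarrow> (real \<Rightarrow> complex) \<Rightarrow> int \<Rightarrow> complex" where
  "cfourier w f k = of_real (w / (2 * pi)) * (\<integral>x. f x * cis (- (of_int k * w * x)) \<partial>period_measure w)"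

lemma space_period_measure: "space (period_measure w) = {0..2 * pi / w}"
  by (simp add: period_measure_def space_restrict_space)

lemma finite_measure_period_measure: "finite_measure (period_measure w)"
  by (rule finite_measureI)
     (simp add: period_measure_def space_restrict_space emeasure_restrict_space emeasure_lborel_Icc_eq)

lemma measure_period_measure: "w > 0 \<Longrightarrow> measure (period_measure w) {0..2 * pi / w} = 2 * pi / w"
  by (simp add: period_measure_def measure_restrict_space)

lemma measurable_period_measure [measurable (raw)]:
  "f \<in> borel_measurable borel \<Longrightarrow> f \<in> borel_measurable (period_measure w)"
  unfolding period_measure_def by (rule measurable_restrict_space1) simp

lemma borel_measurable_cis_mult [measurable]: "(\<lambda>x. cis (a * x)) \<in> borel_measurable borel"
  by (intro borel_measurable_continuous_onI continuous_intros)

lemma integral_period_measure: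
  fixes f :: "real \<Rightarrow> complex"
  assumes "continuous_on {0..2 * pi / w} f"
  shows "(\<integral>x. f x \<partial>period_measure w) = integral {0..2 * pi / w} f"
  unfolding period_measure_def
  using set_borel_integral_eq_integral(2)[OF borel_integrable_atLeastAtMost', OF assms]
  by (simp add: integral_restrict_space set_lebesgue_integral_def)

lemma integrable_period_measure:
  fixes f :: "real \<Rightarrow> complex"
  assumes "f \<in> borel_measurable borel" "\<And>x. 0 \<le> x \<Longrightarrow> x \<le> 2 * pi / w \<Longrightarrow> norm (f x) \<le> B"
  shows "integrable (period_measure w) f"
proof -
  interpret finite_measure "period_measure w" by (rule finite_measure_period_measure)
  show ?thesis
    using assms by (intro integrable_const_bound[of _ B]) (auto simp: space_period_measure)
qed

lemma integral_cis_period_measure: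
  assumes "w > 0"
  shows "(\<integral>x. cis (of_int k * w * x) \<partial>period_measure w) = (if k = 0 then of_real (2 * pi / w) else 0)"
proof (cases "k = 0")
  case True
  then show ?thesis using assms measure_period_measure[of w]
    by (simp add: space_period_measure scaleR_conv_of_real)
next
  case False
  let ?a = "of_int k * w"
  have a: "?a \<noteq> 0" using False assms by simp
  have "((\<lambda>x. cis (?a * x)) has_integral
         (cis (?a * (2 * pi / w)) / (\<i> * ?a) - cis (?a * 0) / (\<i> * ?a))) {0..2 * pi / w}"
  proof (rule fundamental_theorem_of_calculus)
    show "((\<lambda>x. cis (?a * x) / (\<i> * ?a)) has_vector_derivative cis (?a * x)) (at x within {0..2 * pi / w})" for x
      using a unfolding has_vector_derivative_def
      by (auto intro!: derivative_eq_intros simp: scaleR_conv_of_real field_simps)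
  qed (use assms in auto)
  also have "cis (?a * (2 * pi / w)) = 1"
    using assms cis_multiple_2pi[of "of_int k"] by (simp add: field_simps)
  finally have "((\<lambda>x. cis (?a * x)) has_integral 0) {0..2 * pi / w}" by simp
  then have "integral {0..2 * pi / w} (\<lambda>x. cis (?a * x)) = 0" by (rule integral_unique)
  then show ?thesis using False
    by (subst integral_period_measure) (auto intro!: continuous_intros)
qed

lemma cfourier_diff:
  fixes f g :: "real \<Rightarrow> complex"
  assumes "f \<in> borel_measurable borel" "\<And>x. 0 \<le> x \<Longrightarrow> x \<le> 2 * pi / w \<Longrightarrow> norm (f x) \<le> A"
    and "g \<in> borel_measurable borel" "\<And>x. 0 \<le> x \<Longrightarrow> x \<le> 2 * pi / w \<Longrightarrow> norm (g x) \<le> B"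
  shows "cfourier w (\<lambda>x. f x - g x) k = cfourier w f k - cfourier w g k"
proof -
  have [measurable]: "f \<in> borel_measurable borel" "g \<in> borel_measurable borel" by fact+
  have "integrable (period_measure w) (\<lambda>x. f x * cis (- (of_int k * w * x)))"
    using assms(2) borel_measurable_cis_mult[of "- (of_int k * w)"]
    by (intro integrable_period_measure[of _ _ A]) (auto simp: norm_mult)
  moreover have "integrable (period_measure w) (\<lambda>x. g x * cis (- (of_int k * w * x)))"
    using assms(4) borel_measurable_cis_mult[of "- (of_int k * w)"]
    by (intro integrable_period_measure[of _ _ B]) (auto simp: norm_mult)
  ultimately show ?thesis
    by (simp add: cfourier_def left_diff_distrib right_diff_distrib)
qed

text \<open>With \<open>S\<close> the partial Fourier sum, the pointwise inequality
  \<open>|f|\<^sup>2 \<ge> Re ((2f - S) cnj S)\<close> is integrated over a period.\<close>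

lemma bessel_inequality:
  fixes f :: "real \<Rightarrow> complex"
  assumes "w > 0" and [measurable]: "f \<in> borel_measurable borel"
    and B: "\<And>x. 0 \<le> x \<Longrightarrow> x \<le> 2 * pi / w \<Longrightarrow> norm (f x) \<le> B"
    and "finite K"
  shows "(\<Sum>k\<in>K. (norm (cfourier w f k))\<^sup>2) \<le> B\<^sup>2"
proof -
  interpret finite_measure "period_measure w" by (rule finite_measure_period_measure)
  define p where "p = 2 * pi / w"
  have p: "p > 0" using assms by (simp add: p_def)
  let ?M = "period_measure w"
  let ?c = "cfourier w f"
  define e where "e k x = cis (of_int k * w * x)" for k :: int and x :: real
  define S where "S x = (\<Sum>k\<in>K. ?c k * e k x)" for x
  have [measurable]: "e k \<in> borel_measurable borel" for k
    unfolding e_def by measurable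
  have [measurable]: "S \<in> borel_measurable borel"
    unfolding S_def by measurable
  have norm_e [simp]: "norm (e k x) = 1" for k x by (simp add: e_def)
  have cnj_e: "cnj (e k x) = e (- k) x" for k x by (simp add: e_def cis_cnj)
  have ee: "e k x * e l x = e (k + l) x" for k l x by (simp add: e_def cis_mult algebra_simps)
  have int_e: "integrable ?M (\<lambda>x. e k x)" for k
    by (rule integrable_period_measure[of _ _ 1]) auto
  have int_e_eq: "(\<integral>x. e k x \<partial>?M) = (if k = 0 then of_real p else 0)" for k
    unfolding e_def p_def by (rule integral_cis_period_measure[OF \<open>w > 0\<close>])
  have int_fe: "integrable ?M (\<lambda>x. f x * e k x)" for k
    by (rule integrable_period_measure[of _ _ B]) (auto simp: norm_mult B)
  have fe: "(\<integral>x. f x * e (- k) x \<partial>?M) = p * ?c k" for k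
    using assms by (simp add: cfourier_def e_def p_def)
  have Se_eq: "S x * e (- k) x = (\<Sum>l\<in>K. ?c l * e (l - k) x)" for k x
    by (simp add: S_def sum_distrib_right mult.assoc ee)
  have int_Se: "integrable ?M (\<lambda>x. S x * e (- k) x)" for k
    unfolding Se_eq by (intro Bochner_Integration.integrable_sum integrable_mult_right int_e)
  have Se: "(\<integral>x. S x * e (- k) x \<partial>?M) = p * ?c k" if "k \<in> K" for k
  proof -
    have "(\<integral>x. S x * e (- k) x \<partial>?M) = (\<Sum>l\<in>K. ?c l * (\<integral>x. e (l - k) x \<partial>?M))"
      unfolding Se_eq by (subst Bochner_Integration.integral_sum) (auto intro!: integrable_mult_right int_e)
    also have "\<dots> = (\<Sum>l\<in>K. if l = k then ?c k * p else 0)"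
      by (intro sum.cong) (auto simp: int_e_eq)
    also have "\<dots> = p * ?c k" using that \<open>finite K\<close> by (simp add: sum.delta)
    finally show ?thesis .
  qed
  have cnj_S: "cnj (S x) = (\<Sum>k\<in>K. cnj (?c k) * e (- k) x)" for x
    by (simp add: S_def cnj_e)
  \<comment> \<open>Only the conjugate factor is expanded: against \<open>e (- k)\<close> both f and
    S integrate to \<open>p * ?c k\<close>, so each index of \<open>K\<close> contributes p times
    the squared modulus of its coefficient.\<close>
  have D_eq: "(2 * f x - S x) * cnj (S x)
     = (\<Sum>k\<in>K. cnj (?c k) * (2 * (f x * e (- k) x) - S x * e (- k) x))" for x
    unfolding cnj_S sum_distrib_left by (intro sum.cong) (auto simp: algebra_simps)
  have int_D: "integrable ?M (\<lambda>x. (2 * f x - S x) * cnj (S x))"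
    unfolding D_eq
    by (intro Bochner_Integration.integrable_sum integrable_mult_right Bochner_Integration.integrable_diff int_fe int_Se)
  have "(\<integral>x. (2 * f x - S x) * cnj (S x) \<partial>?M) = (\<Sum>k\<in>K. cnj (?c k) * (2 * (p * ?c k) - p * ?c k))"
    unfolding D_eq
    by (subst Bochner_Integration.integral_sum)
       (auto intro!: integrable_mult_right Bochner_Integration.integrable_diff int_fe int_Se sum.cong simp: fe Se int_fe int_Se)
  also have "\<dots> = of_real (p * (\<Sum>k\<in>K. (norm (?c k))\<^sup>2))"
    unfolding of_real_mult of_real_sum sum_distrib_left
    by (intro sum.cong refl) (simp add: complex_norm_square mult_ac del: of_real_power)
  finally have "Re (\<integral>x. (2 * f x - S x) * cnj (S x) \<partial>?M) = p * (\<Sum>k\<in>K. (norm (?c k))\<^sup>2)"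
    by simp
  then have "p * (\<Sum>k\<in>K. (norm (?c k))\<^sup>2) = (\<integral>x. Re ((2 * f x - S x) * cnj (S x)) \<partial>?M)"
    using integral_Re[OF int_D] by simp
  also have "\<dots> \<le> (\<integral>x. B\<^sup>2 \<partial>?M)"
  proof (rule integral_mono)
    fix x assume "x \<in> space ?M"
    then have "norm (f x) \<le> B" by (auto simp: space_period_measure B)
    have "Re ((2 * f x - S x) * cnj (S x)) = (norm (f x))\<^sup>2 - (norm (f x - S x))\<^sup>2"
      unfolding cmod_power2 by (simp add: power2_eq_square algebra_simps)
    also have "\<dots> \<le> B\<^sup>2" using \<open>norm (f x) \<le> B\<close> power_mono[of "norm (f x)" B 2]
      by (smt (verit) norm_ge_zero zero_le_power2)
    finally show "Re ((2 * f x - S x) * cnj (S x)) \<le> B\<^sup>2" .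
  qed (use integrable_Re[OF int_D] in auto)
  also have "\<dots> = p * B\<^sup>2"
    using measure_period_measure[OF \<open>w > 0\<close>] by (simp add: space_period_measure p_def)
  finally show ?thesis using p by simp
qed

lemma integral_period_shift:
  fixes f :: "real \<Rightarrow> complex"
  assumes "p > 0" and cont: "continuous_on UNIV f" and per: "\<And>x. f (x + p) = f x"
  shows "integral {0..p} (\<lambda>x. f (x + h)) = integral {0..p} f"
proof -
  have pos: "integral {0..p} (\<lambda>x. f (x + h)) = integral {0..p} f"
    if cont: "continuous_on UNIV f" and per: "\<And>x. f (x + p) = f x" and "h \<ge> 0"
    for f :: "real \<Rightarrow> complex" and h
  proof -
    have int: "f integrable_on {a..b}" for a b :: real
      by (rule integrable_continuous_real) (rule continuous_on_subset[OF cont], simp)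
    have "integral {0..h} f + integral {h..h + p} f = integral {0..h + p} f"
      using that \<open>p > 0\<close> by (intro Henstock_Kurzweil_Integration.integral_combine int) auto
    also have "\<dots> = integral {0..p} f + integral {p..h + p} f"
      using that \<open>p > 0\<close> by (intro Henstock_Kurzweil_Integration.integral_combine[symmetric] int) auto
    also have "integral {p..h + p} f = integral {0..h} (\<lambda>x. f (x + p))"
      using integral_shift_real_ivl[of p p "h + p" f] by simp
    also have "\<dots> = integral {0..h} f" by (simp add: per)
    finally show ?thesis using integral_shift_real_ivl[of h h "h + p" f] by simp
  qed
  show ?thesis
  proof (cases "h \<ge> 0")
    case True
    then show ?thesis using pos[OF cont per] by simp
  next
    case False
    \<comment> \<open>A negative shift h is undone by the positive shift - h of the translated
      function.\<close>
    have "integral {0..p} (\<lambda>x. f (x + - h + h)) = integral {0..p} (\<lambda>x. f (x + h))"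
    proof (rule pos)
      show "continuous_on UNIV (\<lambda>x. f (x + h))"
        by (rule continuous_on_compose2[OF cont]) (auto intro!: continuous_intros)
      show "f (x + p + h) = f (x + h)" for x using per[of "x + h"] by (simp add: algebra_simps)
    qed (use False in auto)
    then show ?thesis by simp
  qed
qed

text \<open>Translation acts on coefficients by a phase. This yields the coefficients of a
  difference f (x + h) - f x, and it reduces the Fourier series at an arbitrary point to the one at
  0.\<close>

lemma cfourier_shift:
  fixes f :: "real \<Rightarrow> complex"
  assumes "w > 0" and cont: "continuous_on UNIV f" and per: "\<And>x. f (x + 2 * pi / w) = f x"
  shows "cfourier w (\<lambda>x. f (x + h)) k = cis (of_int k * w * h) * cfourier w f k"
proof -
  let ?p = "2 * pi / w"
  let ?F = "\<lambda>x. f x * cis (- (of_int k * w * x))"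
  have contF: "continuous_on UNIV ?F"
    by (intro continuous_intros cont)
  have conth: "continuous_on UNIV (\<lambda>x. f (x + h))"
    by (rule continuous_on_compose2[OF cont]) (auto intro!: continuous_intros)
  have "?F (x + ?p) = ?F x" for x
  proof -
    have "cis (- (of_int k * w * (x + ?p))) = cis (- (of_int k * w * x)) * cis (2 * pi * (- of_int k))"
      using assms by (simp add: cis_mult algebra_simps)
    also have "cis (2 * pi * (- of_int k)) = 1"
      using cis_multiple_2pi[of "- of_int k"] by simp
    finally show ?thesis by (simp add: per)
  qed
  then have "integral {0..?p} (\<lambda>x. ?F (x + h)) = integral {0..?p} ?F"
    using assms by (intro integral_period_shift contF) auto
  moreover have "?F (x + h) = cis (- (of_int k * w * h)) * (f (x + h) * cis (- (of_int k * w * x)))" for x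
    by (simp add: cis_mult algebra_simps)
  ultimately have "cis (- (of_int k * w * h)) * integral {0..?p} (\<lambda>x. f (x + h) * cis (- (of_int k * w * x)))
      = integral {0..?p} ?F" by simp
  then have "cis (of_int k * w * h) * (cis (- (of_int k * w * h)) *
      integral {0..?p} (\<lambda>x. f (x + h) * cis (- (of_int k * w * x)))) = cis (of_int k * w * h) * integral {0..?p} ?F"
    by simp
  then have *: "integral {0..?p} (\<lambda>x. f (x + h) * cis (- (of_int k * w * x))) = cis (of_int k * w * h) * integral {0..?p} ?F"
    by (simp only: mult.assoc[symmetric] cis_mult) simp
  have c1: "continuous_on {0..?p} (\<lambda>x. f (x + h) * cis (- (of_int k * w * x)))"
    by (intro continuous_intros continuous_on_subset[OF conth]) auto
  have c2: "continuous_on {0..?p} ?F"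
    by (rule continuous_on_subset[OF contF]) auto
  show ?thesis unfolding cfourier_def integral_period_measure[OF c1] integral_period_measure[OF c2] *
    by simp
qed

section \<open>Coefficient decay for Lipschitz functions\<close>

lemma jordan_sin_ge:
  fixes y :: real
  assumes "0 \<le> y" "y \<le> pi / 2"
  shows "2 / pi * y \<le> sin y"
proof -
  have "concave_on {0..pi / 2} sin"
  proof (rule f''_le0_imp_concave)
    show "(sin has_real_derivative cos x) (at x)" for x :: real by (rule DERIV_sin)
    show "(cos has_real_derivative - sin x) (at x)" for x :: real by (rule DERIV_cos)
    show "- sin x \<le> 0" if "x \<in> {0..pi / 2}" for x :: real
      using that sin_ge_zero[of x] by auto
  qed auto
  from concave_onD_Icc'[OF this, of y] assms show ?thesis by simp
qed

text \<open>The chord of the angle u has length 2 |sin (u / 2)|, and the concave sine lies above its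
  own chord over the interval from 0 to pi / 2.\<close>

lemma norm_cis_minus_one_ge:
  fixes u :: real
  assumes "\<bar>u\<bar> \<le> pi"
  shows "2 / pi * \<bar>u\<bar> \<le> norm (cis u - 1)"
proof -
  have "norm (cis u - 1) = 2 * \<bar>sin (u / 2)\<bar>"
    using dist_exp_i_1[of u] by (simp add: cis_conv_exp)
  also have "\<bar>sin (u / 2)\<bar> = sin (\<bar>u\<bar> / 2)"
  proof -
    have "sin (\<bar>u\<bar> / 2) \<ge> 0" using assms by (intro sin_ge_zero) auto
    then show ?thesis by (cases "u \<ge> 0") auto
  qed
  also have "2 * sin (\<bar>u\<bar> / 2) \<ge> 2 * (2 / pi * (\<bar>u\<bar> / 2))"
    using assms by (intro mult_left_mono jordan_sin_ge) auto
  finally show ?thesis by simp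
qed

text \<open>Bessel's inequality is applied to the difference \<open>f (x + h) - f x\<close>, whose coefficients are
  \<open>(cis (k w h) - 1)\<close> times those of \<open>f\<close>; no derivative of \<open>f\<close> is needed.\<close>

lemma cfourier_lipschitz_bound:
  fixes f :: "real \<Rightarrow> complex"
  assumes "w > 0" and lip: "L-lipschitz_on UNIV f" and per: "\<And>x. f (x + 2 * pi / w) = f x"
    and "finite K"
  shows "(\<Sum>k\<in>K. (of_int k)\<^sup>2 * (norm (cfourier w f k))\<^sup>2) \<le> (pi * L / (2 * w))\<^sup>2"
proof -
  have cont: "continuous_on UNIV f" using lip by (rule lipschitz_on_continuous_on)
  have meas: "f \<in> borel_measurable borel" using cont by (rule borel_measurable_continuous_onI)
  have conth: "continuous_on UNIV (\<lambda>x. f (x + h))" for h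
    by (rule continuous_on_compose2[OF cont]) (auto intro!: continuous_intros)
  have measd: "(\<lambda>x. f (x + h)) \<in> borel_measurable borel" for h
    using conth by (rule borel_measurable_continuous_onI)
  have "bounded (f ` {0..2 * pi / w})"
    by (intro compact_imp_bounded compact_continuous_image continuous_on_subset[OF cont]) auto
  then obtain A where A: "\<And>x. 0 \<le> x \<Longrightarrow> x \<le> 2 * pi / w \<Longrightarrow> norm (f x) \<le> A"
    unfolding bounded_iff by (meson atLeastAtMost_iff imageI)
  \<comment> \<open>With h = pi / (N w) all angles k w h for k in \<open>K\<close> stay within pi,
    where the chord bound holds. The 1 keeps \<open>N\<close> positive when \<open>K\<close> is
    empty or contains only 0. The value of h cancels in the final quotient, so the bound does not
    depend on \<open>K\<close>.\<close>
  define N where "N = Max (insert 1 ((\<lambda>k. \<bar>real_of_int k\<bar>) ` K))"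
  have N: "N \<ge> 1" "\<And>k. k \<in> K \<Longrightarrow> \<bar>real_of_int k\<bar> \<le> N"
    using \<open>finite K\<close> by (auto simp: N_def)
  define h where "h = pi / (N * w)"
  have h: "h > 0" using N assms by (simp add: h_def)
  have Lh: "norm (f (x + h) - f x) \<le> L * h" for x
    using lipschitz_onD[OF lip, of "x + h" x] h by (simp add: dist_norm)
  have diff: "cfourier w (\<lambda>x. f (x + h) - f x) k = (cis (of_int k * w * h) - 1) * cfourier w f k" for k
  proof -
    have "norm (f (x + h)) \<le> A + L * h" if "0 \<le> x" "x \<le> 2 * pi / w" for x
      using Lh[of x] A[OF that] norm_triangle_sub[of "f (x + h)" "f x"] by linarith
    then have "cfourier w (\<lambda>x. f (x + h) - f x) k = cfourier w (\<lambda>x. f (x + h)) k - cfourier w f k"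
      using A by (intro cfourier_diff measd meas) auto
    then show ?thesis
      using cfourier_shift[OF \<open>w > 0\<close> cont per] by (simp add: algebra_simps)
  qed
  have "(2 * w * h / pi)\<^sup>2 * (\<Sum>k\<in>K. (of_int k)\<^sup>2 * (norm (cfourier w f k))\<^sup>2)
     = (\<Sum>k\<in>K. (2 / pi * \<bar>of_int k * w * h\<bar> * norm (cfourier w f k))\<^sup>2)"
    unfolding sum_distrib_left
    by (intro sum.cong) (auto simp: power_mult_distrib power_divide mult_ac)
  also have "\<dots> \<le> (\<Sum>k\<in>K. (norm (cfourier w (\<lambda>x. f (x + h) - f x) k))\<^sup>2)"
  proof (intro sum_mono power_mono)
    fix k assume k: "k \<in> K"
    have "\<bar>of_int k * w * h\<bar> = \<bar>real_of_int k\<bar> * (pi / N)"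
      using N \<open>w > 0\<close> by (simp add: h_def abs_mult)
    also have "\<dots> \<le> N * (pi / N)" using N k by (intro mult_right_mono) auto
    finally have "\<bar>of_int k * w * h\<bar> \<le> pi" using N by simp
    from norm_cis_minus_one_ge[OF this]
    show "2 / pi * \<bar>of_int k * w * h\<bar> * norm (cfourier w f k) \<le> norm (cfourier w (\<lambda>x. f (x + h) - f x) k)"
      unfolding diff norm_mult by (rule mult_right_mono) auto
  qed auto
  also have "\<dots> \<le> (L * h)\<^sup>2"
    using Lh measd meas by (intro bessel_inequality \<open>w > 0\<close> \<open>finite K\<close>) auto
  finally have "(2 * w * h / pi)\<^sup>2 * (\<Sum>k\<in>K. (of_int k)\<^sup>2 * (norm (cfourier w f k))\<^sup>2) \<le> (L * h)\<^sup>2" .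
  then have "(\<Sum>k\<in>K. (of_int k)\<^sup>2 * (norm (cfourier w f k))\<^sup>2) \<le> (L * h)\<^sup>2 / (2 * w * h / pi)\<^sup>2"
    using h \<open>w > 0\<close> by (simp add: pos_le_divide_eq mult_ac)
  also have "\<dots> = (pi * L / (2 * w))\<^sup>2"
    using h \<open>w > 0\<close> by (simp add: power_divide power_mult_distrib)
  finally show ?thesis .
qed

section \<open>Absolute convergence and value of the Fourier series\<close>

lemma summable_on_int_abs_powr:
  fixes a :: real
  assumes "a < - 1"
  shows "(\<lambda>k::int. \<bar>real_of_int k\<bar> powr a) summable_on UNIV"
proof -
  have nat: "(\<lambda>n::nat. real n powr a) summable_on UNIV"
    using assms by (intro summable_nonneg_imp_summable_on) (auto simp: summable_real_powr_iff)
  have "(\<lambda>k::int. \<bar>real_of_int k\<bar> powr a) summable_on (range int)"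
    using nat by (subst summable_on_reindex) (auto simp: o_def)
  moreover have "(\<lambda>k::int. \<bar>real_of_int k\<bar> powr a) summable_on (range (\<lambda>n. - int n))"
    using nat by (subst summable_on_reindex) (auto simp: o_def inj_def)
  moreover have "range int \<union> range (\<lambda>n. - int n) = (UNIV :: int set)"
    by (auto simp: image_iff) (metis int_cases2)
  ultimately show ?thesis
    using summable_on_union[of _ "range int" "range (\<lambda>n. - int n)"] by metis
qed

text \<open>Split the term as \<open>(|k| * |c k|) * |k| powr (b - 1)\<close> and use x y \<le> x^2
  + y^2: the first squares are summable by the Lipschitz bound, the second because 2b - 2 < -1. The
  index 0 contributes nothing, as \<open>0 powr b\<close> is 0 for every b.\<close>

lemma abs_summable_lipschitz_cfourier:
  fixes f :: "real \<Rightarrow> complex"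
  assumes "w > 0" and lip: "L-lipschitz_on UNIV f" and per: "\<And>x. f (x + 2 * pi / w) = f x"
    and "b < 1 / 2"
  shows "(\<lambda>k. \<bar>real_of_int k\<bar> powr b * norm (cfourier w f k)) summable_on UNIV"
proof (rule summable_on_comparison_test)
  have "(\<lambda>k. (of_int k)\<^sup>2 * (norm (cfourier w f k))\<^sup>2) summable_on UNIV"
    using cfourier_lipschitz_bound[OF assms(1-3)]
    by (intro nonneg_bdd_above_summable_on bdd_aboveI[of _ "(pi * L / (2 * w))\<^sup>2"]) auto
  moreover have "(\<lambda>k::int. \<bar>real_of_int k\<bar> powr (2 * b - 2)) summable_on UNIV"
    using assms by (intro summable_on_int_abs_powr) auto
  ultimately show "(\<lambda>k. (of_int k)\<^sup>2 * (norm (cfourier w f k))\<^sup>2 + \<bar>real_of_int k\<bar> powr (2 * b - 2)) summable_on UNIV"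
    by (rule summable_on_add)
  show "\<bar>real_of_int k\<bar> powr b * norm (cfourier w f k)
      \<le> (of_int k)\<^sup>2 * (norm (cfourier w f k))\<^sup>2 + \<bar>real_of_int k\<bar> powr (2 * b - 2)" for k
  proof (cases "k = 0")
    case False
    let ?k = "\<bar>real_of_int k\<bar>" and ?c = "norm (cfourier w f k)"
    have k: "?k > 0" using False by simp
    have "?k powr b * ?c = (?k * ?c) * ?k powr (b - 1)" using k by (simp add: powr_diff)
    also have "\<dots> \<le> (?k * ?c)\<^sup>2 + (?k powr (b - 1))\<^sup>2"
    proof -
      have "x * y \<le> x\<^sup>2 + y\<^sup>2" for x y :: real
      proof -
        have "2 * (x * y) \<le> x\<^sup>2 + y\<^sup>2" using sum_squares_bound[of x y] by (simp add: mult.assoc)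
        then show ?thesis using zero_le_power2[of x] zero_le_power2[of y] by linarith
      qed
      then show ?thesis .
    qed
    also have "(?k powr (b - 1))\<^sup>2 = ?k powr (2 * b - 2)"
      using k by (simp add: powr_power algebra_simps)
    finally show ?thesis by (simp add: power_mult_distrib)
  qed simp
qed (auto intro!: add_nonneg_nonneg)

text \<open>Turns an unordered sum over the integers into the limit of a sequence, the form needed
  for telescoping and for dominated convergence.\<close>

lemma filterlim_symmetric_int_intervals:
  "filterlim (\<lambda>n. {- int n..int n}) (finite_subsets_at_top UNIV) sequentially"
  unfolding filterlim_finite_subsets_at_top
proof (intro allI impI)
  fix X :: "int set" assume "finite X \<and> X \<subseteq> UNIV"
  then have fin: "finite X" by simp
  define N where "N = Max (insert 0 ((\<lambda>k. nat \<bar>k\<bar>) ` X))"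
  have N: "nat \<bar>k\<bar> \<le> N" if "k \<in> X" for k
    using fin that by (auto simp: N_def)
  show "\<forall>\<^sub>F n in sequentially. finite {- int n..int n} \<and> X \<subseteq> {- int n..int n} \<and> {- int n..int n} \<subseteq> UNIV"
    using eventually_ge_at_top[of N]
  proof eventually_elim
    case (elim n)
    have "k \<in> {- int n..int n}" if "k \<in> X" for k
      using N[OF that] elim by auto
    then show ?case by auto
  qed
qed

text \<open>Chernoff's argument: \<open>f x - f 0 = g x * (cis (w x) - 1)\<close> with \<open>g\<close> bounded, so the
  symmetric partial sums of the coefficients of \<open>f - f 0\<close> telescope to coefficients of \<open>g\<close>,
  which tend to zero by Bessel's inequality.\<close>

lemma fourier_series_lipschitz_at_0:
  fixes f :: "real \<Rightarrow> complex"
  assumes "w > 0" and lip: "L-lipschitz_on UNIV f" and per: "\<And>x. f (x + 2 * pi / w) = f x"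
  shows "(cfourier w f has_sum f 0) UNIV"
proof -
  let ?p = "2 * pi / w"
  \<comment> \<open>At the zeros of the denominator g is 0. This does no harm: \<open>bound\<close>
    shows that f x = f 0 wherever the denominator vanishes in the period, both ends
    included.\<close>
  define g where "g x = (f x - f 0) / (cis (w * x) - 1)" for x
  define C where "C = L * pi / (2 * w)"
  have L: "L \<ge> 0" using lip by (rule lipschitz_on_nonneg)
  have cont: "continuous_on UNIV f" using lip by (rule lipschitz_on_continuous_on)
  have [measurable]: "f \<in> borel_measurable borel" using cont by (rule borel_measurable_continuous_onI)
  have [measurable]: "g \<in> borel_measurable borel" unfolding g_def by measurable
  have bound: "norm (f x - f 0) \<le> C * norm (cis (w * x) - 1)" if x: "0 \<le> x" "x \<le> ?p" for x
  proof -
    \<comment> \<open>Here y stands for x or for x minus one period, whichever lies within half a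
      period of 0, so that the chord bound applies. The constant \<open>C\<close> is L / w times the
      factor pi / 2 of that bound.\<close>
    have near: "norm (f x - f 0) \<le> C * norm (cis (w * x) - 1)"
      if "norm (f x - f 0) \<le> L * \<bar>y\<bar>" "cis (w * x) = cis (w * y)" "\<bar>w * y\<bar> \<le> pi" for y
    proof -
      have "norm (f x - f 0) \<le> C * (2 / pi * \<bar>w * y\<bar>)"
        using that(1) \<open>w > 0\<close> by (simp add: C_def abs_mult)
      also have "\<dots> \<le> C * norm (cis (w * y) - 1)"
        using L \<open>w > 0\<close> that(3) by (intro mult_left_mono norm_cis_minus_one_ge) (auto simp: C_def)
      finally show ?thesis by (simp add: that(2))
    qed
    show ?thesis
    proof (cases "w * x \<le> pi")
      case True
      show ?thesis
        by (rule near[of x]) (use lipschitz_onD[OF lip, of x 0] True x \<open>w > 0\<close> in \<open>auto simp: dist_norm\<close>)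
    next
      case False
      have "norm (f x - f 0) \<le> L * \<bar>x - ?p\<bar>"
        using lipschitz_onD[OF lip, of x ?p] per[of 0] by (simp add: dist_norm)
      moreover have "w * (x - ?p) = w * x - 2 * pi" using \<open>w > 0\<close> by (simp add: algebra_simps)
      moreover have "cis (w * x - 2 * pi) = cis (w * x)" by (simp add: cis_divide[symmetric])
      moreover have "w * x \<le> 2 * pi" using x \<open>w > 0\<close> by (simp add: field_simps)
      ultimately show ?thesis
        using False by (intro near[of "x - ?p"]) auto
    qed
  qed
  have g_bound: "norm (g x) \<le> C" if "0 \<le> x" "x \<le> ?p" for x
    using bound[OF that] L \<open>w > 0\<close> by (auto simp: g_def norm_divide divide_le_eq C_def)
  have fg: "f x - f 0 = g x * (cis (w * x) - 1)" if "0 \<le> x" "x \<le> ?p" for x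
    using bound[OF that] by (auto simp: g_def)
  have "bounded (f ` {0..2 * pi / w})"
    by (intro compact_imp_bounded compact_continuous_image continuous_on_subset[OF cont]) auto
  then obtain A where A: "\<And>x. 0 \<le> x \<Longrightarrow> x \<le> 2 * pi / w \<Longrightarrow> norm (f x) \<le> A"
    unfolding bounded_iff by (meson atLeastAtMost_iff imageI)
  \<comment> \<open>Multiplying g by \<open>cis (w * x)\<close> moves its coefficients by one index,
    which creates the telescoping difference.\<close>
  have coeff: "cfourier w f k = (if k = 0 then f 0 else 0) + (cfourier w g (k - 1) - cfourier w g k)" for k
  proof -
    have "cfourier w (\<lambda>x. f x - f 0) k = cfourier w f k - cfourier w (\<lambda>x. f 0) k"
      using A by (intro cfourier_diff[of _ _ A _ "norm (f 0)"]) auto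
    moreover have "cfourier w (\<lambda>x. f 0) k = (if k = 0 then f 0 else 0)"
      using integral_cis_period_measure[OF \<open>w > 0\<close>, of "- k"] \<open>w > 0\<close> by (simp add: cfourier_def)
    moreover have "cfourier w (\<lambda>x. f x - f 0) k = cfourier w (\<lambda>x. g x * cis (w * x) - g x) k"
      unfolding cfourier_def
      by (intro arg_cong[where f = "(*) _"] Bochner_Integration.integral_cong)
         (auto simp: space_period_measure fg algebra_simps)
    moreover have "cfourier w (\<lambda>x. g x * cis (w * x) - g x) k
        = cfourier w (\<lambda>x. g x * cis (w * x)) k - cfourier w g k"
      using g_bound by (intro cfourier_diff[of _ _ C _ C]) (auto simp: norm_mult)
    moreover have "cfourier w (\<lambda>x. g x * cis (w * x)) k = cfourier w g (k - 1)"
      unfolding cfourier_def by (simp add: mult.assoc cis_mult algebra_simps)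
    ultimately show ?thesis by simp
  qed
  have partial: "(\<Sum>k\<in>{- int n..int n}. cfourier w f k) = f 0 + (cfourier w g (- int n - 1) - cfourier w g (int n))" for n
  proof (induction n)
    case (Suc n)
    have "{- int (Suc n)..int (Suc n)} = insert (- int (Suc n)) (insert (int (Suc n)) {- int n..int n})" by auto
    then have "(\<Sum>k\<in>{- int (Suc n)..int (Suc n)}. cfourier w f k)
        = cfourier w f (- int (Suc n)) + cfourier w f (int (Suc n)) + (\<Sum>k\<in>{- int n..int n}. cfourier w f k)"
      by simp
    moreover have "cfourier w f (int (Suc n)) = cfourier w g (int n) - cfourier w g (int (Suc n))"
      using coeff[of "int (Suc n)"] by simp
    moreover have "cfourier w f (- int (Suc n)) = cfourier w g (- int (Suc n) - 1) - cfourier w g (- int n - 1)"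
    proof -
      have "- int (Suc n) = - int n - 1" "- int (Suc n) \<noteq> 0" by simp_all
      with coeff[of "- int (Suc n)"] show ?thesis by (metis add_0)
    qed
    ultimately show ?case using Suc by simp
  qed (use coeff[of 0] in simp)
  \<comment> \<open>Injectivity makes the \<open>h n\<close> distinct indices, so Bessel's
    inequality bounds all partial sums of the squared moduli.\<close>
  have decay: "(\<lambda>n. cfourier w g (h n)) \<longlonglongrightarrow> 0" if "inj h" for h :: "nat \<Rightarrow> int"
  proof -
    have "(\<Sum>n<N. (norm (cfourier w g (h n)))\<^sup>2) \<le> C\<^sup>2" for N
    proof -
      have "(\<Sum>n<N. (norm (cfourier w g (h n)))\<^sup>2) = (\<Sum>k\<in>h ` {..<N}. (norm (cfourier w g k))\<^sup>2)"
        using that by (subst sum.reindex) (auto intro: inj_on_subset)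
      also have "\<dots> \<le> C\<^sup>2" using g_bound by (intro bessel_inequality \<open>w > 0\<close>) auto
      finally show ?thesis .
    qed
    then have "summable (\<lambda>n. (norm (cfourier w g (h n)))\<^sup>2)"
      by (intro summableI_nonneg_bounded) auto
    then have "(\<lambda>n. (norm (cfourier w g (h n)))\<^sup>2) \<longlonglongrightarrow> 0" by (rule summable_LIMSEQ_zero)
    then have "(\<lambda>n. sqrt ((norm (cfourier w g (h n)))\<^sup>2)) \<longlonglongrightarrow> sqrt 0" by (rule tendsto_real_sqrt)
    then show ?thesis by (simp add: tendsto_norm_zero_iff)
  qed
  have lim: "(\<lambda>n. \<Sum>k\<in>{- int n..int n}. cfourier w f k) \<longlonglongrightarrow> f 0 + (0 - 0)"
    unfolding partial by (intro tendsto_intros decay) (auto simp: inj_def)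
  \<comment> \<open>For b = 0 the weight is 1 except at k = 0, where \<open>0 powr 0\<close> is 0;
    that index is therefore removed and added back as a finite set.\<close>
  have "(\<lambda>k. norm (cfourier w f k)) summable_on UNIV - {0}"
    by (rule summable_on_cong[THEN iffD1, OF _ summable_on_subset_banach[OF abs_summable_lipschitz_cfourier[OF assms, of 0]]])
       auto
  from summable_on_union[OF this summable_on_finite[of "{0}"]]
  have "(\<lambda>k. norm (cfourier w f k)) summable_on UNIV" by simp
  then have "cfourier w f summable_on UNIV" by (rule abs_summable_summable)
  then have "(cfourier w f has_sum infsum (cfourier w f) UNIV) UNIV" by (rule has_sum_infsum)
  moreover from this have "(\<lambda>n. \<Sum>k\<in>{- int n..int n}. cfourier w f k) \<longlonglongrightarrow> infsum (cfourier w f) UNIV"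
    unfolding has_sum_def by (rule filterlim_compose[OF _ filterlim_symmetric_int_intervals])
  \<comment> \<open>Absolute summability provides an unordered sum; the telescoped symmetric partial
    sums only identify its value.\<close>
  then have "infsum (cfourier w f) UNIV = f 0" using lim LIMSEQ_unique by fastforce
  ultimately show ?thesis by simp
qed

lemma fourier_series_lipschitz:
  fixes f :: "real \<Rightarrow> complex"
  assumes "w > 0" and lip: "L-lipschitz_on UNIV f" and per: "\<And>x. f (x + 2 * pi / w) = f x"
  shows "((\<lambda>k. cfourier w f k * cis (of_int k * w * x)) has_sum f x) UNIV"
proof -
  have cont: "continuous_on UNIV f" using lip by (rule lipschitz_on_continuous_on)
  have "(cfourier w (\<lambda>y. f (y + x)) has_sum f (0 + x)) UNIV"
  proof (rule fourier_series_lipschitz_at_0[OF \<open>w > 0\<close>])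
    show "L-lipschitz_on UNIV (\<lambda>y. f (y + x))"
      using lipschitz_onD[OF lip, of "a + x" "b + x" for a b] lipschitz_on_nonneg[OF lip]
      by (intro lipschitz_onI) (auto simp: dist_norm)
    show "f (y + 2 * pi / w + x) = f (y + x)" for y
      using per[of "y + x"] by (simp add: algebra_simps)
  qed
  moreover have "cfourier w (\<lambda>y. f (y + x)) = (\<lambda>k. cfourier w f k * cis (of_int k * w * x))"
    using cfourier_shift[OF \<open>w > 0\<close> cont per] by (intro ext) simp
  ultimately show ?thesis by simp
qed

subsection \<open>Piecewise continuously differentiable periodic functions\<close>

lemma periodic_add_int_multiple:
  fixes f :: "real \<Rightarrow> 'a"
  assumes per: "\<And>x. f (x + p) = f x"
  shows "f (x + of_int n * p) = f x"
proof -
  have nat: "f (x + real m * p) = f x" for m x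
  proof (induction m)
    case (Suc m)
    have "f (x + real (Suc m) * p) = f ((x + real m * p) + p)" by (simp add: algebra_simps)
    then show ?case using per Suc by simp
  qed simp
  show ?thesis
  proof (cases "n \<ge> 0")
    case True
    then show ?thesis using nat[of x "nat n"] by simp
  next
    case False
    then obtain m where m: "n = - int m"
      by (metis int_cases2 linorder_le_cases of_nat_0_le_iff)
    show ?thesis using nat[of "x - real m * p" m] by (simp add: m)
  qed
qed

text \<open>The finite one-sided limits bound the derivative on a punctured neighbourhood of t. The
  mean value theorem then applies on each side, since it asks only for continuity at the endpoint t,
  and an interval across t is cut there.\<close>

lemma piecewise_C1_locally_lipschitz:
  fixes f :: "real \<Rightarrow> real"
  assumes "piecewise_C1 f" and cont: "continuous_on UNIV f"
  shows "\<exists>d>0. \<exists>B. \<forall>x y. t - d \<le> x \<and> x \<le> y \<and> y \<le> t + d \<longrightarrow> \<bar>f y - f x\<bar> \<le> B * (y - x)"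
proof -
  have "f piecewise_C1_differentiable_on {t - 1..t + 1}"
    using assms by (auto simp: piecewise_C1_def)
  then obtain S where S: "finite S" "f C1_differentiable_on ({t - 1..t + 1} - S)"
    by (auto simp: piecewise_C1_differentiable_on_def)
  have deriv: "(f has_real_derivative deriv f x) (at x)" if "x \<in> {t - 1..t + 1} - S" for x
  proof -
    from S(2) obtain D where "\<forall>x\<in>{t - 1..t + 1} - S. (f has_vector_derivative D x) (at x)"
      unfolding C1_differentiable_on_def by blast
    with that have "(f has_vector_derivative D x) (at x)" by blast
    then have D: "(f has_real_derivative D x) (at x)"
      by (simp add: has_real_derivative_iff_has_vector_derivative)
    then have "deriv f x = D x" by (rule DERIV_imp_deriv)
    with D show ?thesis by simp
  qed
  obtain l r where lr: "(deriv f \<longlongrightarrow> l) (at_left t)" "(deriv f \<longlongrightarrow> r) (at_right t)"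
    using assms(1) unfolding piecewise_C1_def by blast
  define B where "B = max (\<bar>l\<bar> + 1) (\<bar>r\<bar> + 1)"
  have "\<forall>\<^sub>F x in at_left t. \<bar>deriv f x\<bar> < B" "\<forall>\<^sub>F x in at_right t. \<bar>deriv f x\<bar> < B"
    using order_tendstoD(2)[OF tendsto_rabs[OF lr(1)], of B] order_tendstoD(2)[OF tendsto_rabs[OF lr(2)], of B]
    by (auto simp: B_def)
  then have "\<forall>\<^sub>F x in at t. \<bar>deriv f x\<bar> < B"
    by (simp add: eventually_at_split)
  \<comment> \<open>The finitely many breakpoints other than t keep a positive distance from
    t.\<close>
  moreover have "\<forall>\<^sub>F x in at t. x \<notin> S"
  proof -
    have "open (- (S - {t}))"
      by (intro open_Compl finite_imp_closed finite_Diff S(1))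
    then have "\<forall>\<^sub>F x in at t. x \<in> - (S - {t}) - {t}"
      by (rule eventually_at_in_open) auto
    then show ?thesis by eventually_elim auto
  qed
  moreover have "\<forall>\<^sub>F x in at t. x \<in> {t - 1<..<t + 1}"
    by (intro eventually_at_in_open') auto
  ultimately have "\<forall>\<^sub>F x in at t. (f has_real_derivative deriv f x) (at x) \<and> \<bar>deriv f x\<bar> < B"
    by eventually_elim (use deriv in auto)
  then obtain d where d: "d > 0"
    "\<And>x. x \<noteq> t \<Longrightarrow> \<bar>x - t\<bar> < d \<Longrightarrow> (f has_real_derivative deriv f x) (at x) \<and> \<bar>deriv f x\<bar> < B"
    by (auto simp: eventually_at dist_real_def)
  have side: "\<bar>f y - f x\<bar> \<le> B * (y - x)"
    if "x < y" "t - d / 2 \<le> x" "y \<le> t + d / 2" "y \<le> t \<or> t \<le> x" for x y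
  proof -
    have *: "(f has_real_derivative deriv f z) (at z) \<and> \<bar>deriv f z\<bar> < B" if "x < z" "z < y" for z
      by (rule d(2)) (use \<open>t - d / 2 \<le> x\<close> \<open>y \<le> t + d / 2\<close> \<open>y \<le> t \<or> t \<le> x\<close> that d(1) in auto)
    have "\<exists>l z. x < z \<and> z < y \<and> DERIV f z :> l \<and> f y - f x = (y - x) * l"
    proof (rule MVT)
      show "f differentiable (at z)" if "x < z" "z < y" for z
        using *[OF that] by (auto simp: real_differentiable_def)
    qed (use that continuous_on_subset[OF cont] in auto)
    then obtain l z where z: "x < z" "z < y" "DERIV f z :> l" "f y - f x = (y - x) * l" by blast
    have "l = deriv f z" using z(3) by (simp add: DERIV_imp_deriv)
    then have "\<bar>l\<bar> \<le> B" using *[OF z(1,2)] by simp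
    then have "\<bar>l\<bar> * (y - x) \<le> B * (y - x)"
      using \<open>x < y\<close> by (intro mult_right_mono) auto
    then show ?thesis
      using z(4) \<open>x < y\<close> by (simp add: abs_mult mult.commute)
  qed
  have "\<bar>f y - f x\<bar> \<le> B * (y - x)" if xy: "t - d / 2 \<le> x" "x \<le> y" "y \<le> t + d / 2" for x y
  proof (cases "x < t \<and> t < y")
    case True
    then have "\<bar>f t - f x\<bar> \<le> B * (t - x)" "\<bar>f y - f t\<bar> \<le> B * (y - t)"
      using xy d(1) by (auto intro!: side)
    then show ?thesis by (simp add: algebra_simps)
  next
    case False
    then show ?thesis using xy side[of x y] by (cases "x = y") auto
  qed
  then have "\<forall>x y. t - d / 2 \<le> x \<and> x \<le> y \<and> y \<le> t + d / 2 \<longrightarrow> \<bar>f y - f x\<bar> \<le> B * (y - x)"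
    by blast
  then show ?thesis using d(1) half_gt_zero by blast
qed

text \<open>A Lipschitz bound on adjacent intervals extends to their union, so bisection turns the
  local bounds into one on a compact interval, and periodicity carries it to the whole line.\<close>

lemma piecewise_C1_periodic_lipschitz:
  fixes f :: "real \<Rightarrow> real"
  assumes "piecewise_C1 f" and "continuous_on UNIV f" and "p > 0" and per: "\<And>x. f (x + p) = f x"
  obtains L where "L-lipschitz_on UNIV f"
proof -
  \<comment> \<open>Two periods are needed: one for the reduced point and one for the reduced
    increment.\<close>
  have "\<exists>B. \<forall>x y. 0 \<le> x \<and> x \<le> y \<and> y \<le> 2 * p \<longrightarrow> \<bar>f y - f x\<bar> \<le> B * (y - x)"
  proof (rule Bolzano)
    show "0 \<le> 2 * p" using \<open>p > 0\<close> by simp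
  next
    fix a b c :: real
    assume "\<exists>B. \<forall>x y. a \<le> x \<and> x \<le> y \<and> y \<le> b \<longrightarrow> \<bar>f y - f x\<bar> \<le> B * (y - x)"
      and "\<exists>B. \<forall>x y. b \<le> x \<and> x \<le> y \<and> y \<le> c \<longrightarrow> \<bar>f y - f x\<bar> \<le> B * (y - x)"
      and abc: "a \<le> b" "b \<le> c"
    then obtain B1 B2 where
      B1: "\<And>x y. a \<le> x \<Longrightarrow> x \<le> y \<Longrightarrow> y \<le> b \<Longrightarrow> \<bar>f y - f x\<bar> \<le> B1 * (y - x)" and
      B2: "\<And>x y. b \<le> x \<Longrightarrow> x \<le> y \<Longrightarrow> y \<le> c \<Longrightarrow> \<bar>f y - f x\<bar> \<le> B2 * (y - x)" by blast
    define B where "B = max B1 B2"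
    have B1': "\<bar>f y - f x\<bar> \<le> B * (y - x)" if "a \<le> x" "x \<le> y" "y \<le> b" for x y
      by (rule order.trans[OF B1[OF that] mult_right_mono]) (use that in \<open>auto simp: B_def\<close>)
    have B2': "\<bar>f y - f x\<bar> \<le> B * (y - x)" if "b \<le> x" "x \<le> y" "y \<le> c" for x y
      by (rule order.trans[OF B2[OF that] mult_right_mono]) (use that in \<open>auto simp: B_def\<close>)
    have "\<bar>f y - f x\<bar> \<le> B * (y - x)" if "a \<le> x" "x \<le> y" "y \<le> c" for x y
    proof (cases "x \<le> b \<and> b \<le> y")
      case True
      then show ?thesis using B1'[of x b] B2'[of b y] that by (simp add: algebra_simps)
    next
      case False
      then show ?thesis using B1'[of x y] B2'[of x y] that by linarith
    qed
    then show "\<exists>B. \<forall>x y. a \<le> x \<and> x \<le> y \<and> y \<le> c \<longrightarrow> \<bar>f y - f x\<bar> \<le> B * (y - x)" by blast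
  next
    fix t :: real
    obtain d B where "d > 0" "\<And>x y. t - d \<le> x \<Longrightarrow> x \<le> y \<Longrightarrow> y \<le> t + d \<Longrightarrow> \<bar>f y - f x\<bar> \<le> B * (y - x)"
      using piecewise_C1_locally_lipschitz[OF assms(1,2), of t] by blast
    then have "\<forall>a b. a \<le> t \<and> t \<le> b \<and> b - a < d \<longrightarrow>
        (\<forall>x y. a \<le> x \<and> x \<le> y \<and> y \<le> b \<longrightarrow> \<bar>f y - f x\<bar> \<le> B * (y - x))"
      by auto
    then show "\<exists>d>0. \<forall>a b. a \<le> t \<and> t \<le> b \<and> b - a < d \<longrightarrow>
        (\<exists>B. \<forall>x y. a \<le> x \<and> x \<le> y \<and> y \<le> b \<longrightarrow> \<bar>f y - f x\<bar> \<le> B * (y - x))"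
      using \<open>d > 0\<close> by blast
  qed
  then obtain B where B: "\<And>x y. 0 \<le> x \<Longrightarrow> x \<le> y \<Longrightarrow> y \<le> 2 * p \<Longrightarrow> \<bar>f y - f x\<bar> \<le> B * (y - x)" by blast
  have "0 \<le> B * p" using B[of 0 p] \<open>p > 0\<close> by simp
  then have "B \<ge> 0" using \<open>p > 0\<close> by (simp add: zero_le_mult_iff)
  have main: "\<bar>f y - f x\<bar> \<le> B * (y - x)" if "x \<le> y" for x y
  proof -
    \<comment> \<open>Both x and the increment y - x are reduced modulo p. Then f y = f (x' + r),
      and reducing the increment only shrinks it, so the bound for r gives the one for y -
      x.\<close>
    define x' where "x' = x - of_int \<lfloor>x / p\<rfloor> * p"
    define r where "r = (y - x) - of_int \<lfloor>(y - x) / p\<rfloor> * p"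
    have x': "0 \<le> x'" "x' \<le> p"
      using floor_divide_lower[OF \<open>p > 0\<close>, of x] floor_divide_upper[OF \<open>p > 0\<close>, of x]
      by (auto simp: x'_def algebra_simps)
    have r: "0 \<le> r" "r \<le> p"
      using floor_divide_lower[OF \<open>p > 0\<close>, of "y - x"] floor_divide_upper[OF \<open>p > 0\<close>, of "y - x"]
      by (auto simp: r_def algebra_simps)
    have "r \<le> y - x" using that \<open>p > 0\<close> by (simp add: r_def)
    have "f x = f x'"
      using periodic_add_int_multiple[of f, OF per, of x' "\<lfloor>x / p\<rfloor>"] by (simp add: x'_def)
    moreover have "f y = f (x' + r)"
      using periodic_add_int_multiple[of f, OF per, of "x' + r" "\<lfloor>x / p\<rfloor> + \<lfloor>(y - x) / p\<rfloor>"]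
      by (simp add: x'_def r_def algebra_simps)
    moreover have "\<bar>f (x' + r) - f x'\<bar> \<le> B * (x' + r - x')"
      using x' r by (intro B) auto
    moreover have "B * r \<le> B * (y - x)"
      using \<open>B \<ge> 0\<close> \<open>r \<le> y - x\<close> by (rule mult_left_mono[rotated])
    ultimately show ?thesis by simp
  qed
  have "B-lipschitz_on UNIV f"
  proof (rule lipschitz_onI)
    show "dist (f x) (f y) \<le> B * dist x y" for x y
      using main[of x y] main[of y x] by (cases "x \<le> y") (auto simp: dist_real_def abs_minus_commute)
  qed fact
  then show ?thesis by (rule that)
qed

subsection \<open>Mellin transforms of exponentials\<close>

text \<open>The power of a positive real, without the case distinction of \<open>powr\<close> at 0:
  measurability and the exponent law follow from those of \<open>exp\<close> for every r. It is
  meant for r > 0 only.\<close>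

definition rpow :: "complex \<Rightarrow> real \<Rightarrow> complex" where
  "rpow s r = exp (s * of_real (ln r))"

lemma rpow_eq_powr: "r > 0 \<Longrightarrow> rpow s r = of_real r powr s"
  by (simp add: rpow_def powr_def Ln_of_real)

lemma norm_rpow: "r > 0 \<Longrightarrow> norm (rpow s r) = r powr Re s"
  by (simp add: rpow_def powr_def)

lemma rpow_add: "rpow (s + t) r = rpow s r * rpow t r"
  by (simp add: rpow_def ring_distribs exp_add)

lemma rpow_of_nat: "r > 0 \<Longrightarrow> rpow (of_nat n) r = of_real r ^ n"
  by (simp add: rpow_def exp_of_nat_mult exp_of_real)

lemma rpow_of_real: "r > 0 \<Longrightarrow> rpow (of_real a) r = of_real (r powr a)"
  by (simp add: rpow_eq_powr powr_of_real)

lemma rpow_mult_real: "a > 0 \<Longrightarrow> r > 0 \<Longrightarrow> rpow s (a * r) = rpow s a * rpow s r"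
  by (simp add: rpow_def ln_mult ring_distribs exp_add)

lemma borel_measurable_rpow [measurable]: "rpow s \<in> borel_measurable borel"
  unfolding rpow_def by measurable

lemma set_integrable_lborel_iff_lebesgue:
  fixes f :: "real \<Rightarrow> 'b :: euclidean_space"
  assumes "f \<in> borel_measurable borel" "S \<in> sets borel"
  shows "f absolutely_integrable_on S \<longleftrightarrow> set_integrable lborel S f"
  unfolding set_integrable_def using assms by (intro integrable_completion) auto

lemma Gamma_integral_rpow:
  assumes "Re s > 0"
  shows "set_integrable lborel {0<..} (\<lambda>u. of_real (exp (- u)) * rpow (s - 1) u)"
    and "(LBINT u:{0<..}. of_real (exp (- u)) * rpow (s - 1) u) = Gamma s"
proof -
  have eq: "of_real u powr (s - 1) / of_real (exp u) = of_real (exp (- u)) * rpow (s - 1) u" if "u \<in> {0<..}" for u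
    using that by (simp add: rpow_eq_powr exp_minus field_simps)
  have "(\<lambda>u. of_real (exp (- u)) * rpow (s - 1) u) absolutely_integrable_on {0<..}"
    using absolutely_integrable_Gamma_integral'[OF assms] eq
    by (subst set_integrable_cong[OF refl refl eq[symmetric]]) auto
  then show *: "set_integrable lborel {0<..} (\<lambda>u. of_real (exp (- u)) * rpow (s - 1) u)"
    by (subst (asm) set_integrable_lborel_iff_lebesgue) auto
  have "((\<lambda>u. of_real (exp (- u)) * rpow (s - 1) u) has_integral Gamma s) {0<..}"
    using Gamma_integral_complex'[OF assms] by (rule has_integral_eq[rotated]) (use eq in auto)
  then show "(LBINT u:{0<..}. of_real (exp (- u)) * rpow (s - 1) u) = Gamma s"
    using set_borel_integral_eq_integral(2)[OF *] by (simp add: integral_unique)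
qed

lemma Gamma_integral_rpow_norm:
  fixes \<sigma> :: real
  assumes "\<sigma> > 0"
  shows "(LBINT u:{0<..}. exp (- u) * u powr (\<sigma> - 1)) = Gamma \<sigma>"
proof -
  have "of_real (LBINT u:{0<..}. exp (- u) * u powr (\<sigma> - 1))
     = (LBINT u:{0<..}. complex_of_real (exp (- u) * u powr (\<sigma> - 1)))"
    by (simp add: set_lebesgue_integral_def scaleR_conv_of_real flip: integral_complex_of_real)
  also have "\<dots> = (LBINT u:{0<..}. of_real (exp (- u)) * rpow (of_real \<sigma> - 1) u)"
    using rpow_of_real[of _ "\<sigma> - 1"] by (intro set_lebesgue_integral_cong) auto
  also have "\<dots> = of_real (Gamma \<sigma>)"
    using Gamma_integral_rpow(2)[of "of_real \<sigma>"] assms by (simp add: Gamma_complex_of_real)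
  finally show ?thesis by (simp only: of_real_eq_iff)
qed

text \<open>Expand \<open>exp (- w u) = exp (- u) exp ((1 - w) u)\<close> in powers of \<open>1 - w\<close> and integrate
  termwise: the result is the binomial series of \<open>w powr (- s)\<close>.\<close>

lemma laplace_rpow_near_1:
  assumes s: "Re s > 0" and w: "norm (w - 1) < 1"
  shows "set_integrable lborel {0<..} (\<lambda>u. exp (- w * of_real u) * rpow (s - 1) u)"
    and "(LBINT u:{0<..}. exp (- w * of_real u) * rpow (s - 1) u) = Gamma s * w powr (- s)"
proof -
  define f where "f n u = indicator {0<..} u *\<^sub>R ((1 - w) ^ n / fact n * (of_real (exp (- u)) * rpow (s + of_nat n - 1) u))"
    for n :: nat and u :: real
  have ns: "s \<notin> \<int>\<^sub>\<le>\<^sub>0" using s by (auto elim!: nonpos_Ints_cases)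
  have nsr: "Re s \<notin> \<int>\<^sub>\<le>\<^sub>0" using s by (auto elim!: nonpos_Ints_cases)
  have f_int: "integrable lborel (f n)" for n
    using Gamma_integral_rpow(1)[of "s + of_nat n"] s
    unfolding f_def set_integrable_def mult_scaleR_right[symmetric] by (intro integrable_mult_right) simp
  have f_eq: "f n u = indicator {0<..} u *\<^sub>R (of_real (exp (- u)) * rpow (s - 1) u * (((1 - w) * of_real u) ^ n / fact n))" for n u
  proof (cases "u > 0")
    case True
    have "rpow (s + of_nat n - 1) u = rpow (s - 1) u * of_real u ^ n"
      using rpow_add[of "s - 1" "of_nat n" u] rpow_of_nat[OF True, of n] by (simp add: algebra_simps)
    then show ?thesis using True by (simp add: f_def power_mult_distrib)
  qed (simp add: f_def)
  have f_sums: "(\<lambda>n. f n u) sums (indicator {0<..} u *\<^sub>R (exp (- w * of_real u) * rpow (s - 1) u))" for u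
  proof -
    have "(\<lambda>n. ((1 - w) * of_real u) ^ n / fact n) sums exp ((1 - w) * of_real u)"
      using exp_converges[of "(1 - w) * of_real u"] by (simp add: scaleR_conv_of_real field_simps)
    then have "(\<lambda>n. f n u) sums (indicator {0<..} u *\<^sub>R (of_real (exp (- u)) * rpow (s - 1) u * exp ((1 - w) * of_real u)))"
      unfolding f_eq by (intro sums_scaleR_right sums_mult)
    also have "of_real (exp (- u)) * rpow (s - 1) u * exp ((1 - w) * of_real u) = exp (- w * of_real u) * rpow (s - 1) u"
      by (simp add: exp_of_real[symmetric] exp_add[symmetric] algebra_simps)
    finally show ?thesis .
  qed
  have norm_f: "norm (f n u) = norm (1 - w) ^ n / fact n * (indicator {0<..} u *\<^sub>R (exp (- u) * u powr (Re s + n - 1)))" for n u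
    by (cases "u > 0") (simp_all add: f_def norm_mult norm_divide norm_power norm_rpow)
  have int_norm: "(LBINT u. norm (f n u)) = norm (1 - w) ^ n / fact n * Gamma (Re s + n)" for n
    unfolding norm_f using Gamma_integral_rpow_norm[of "Re s + n"] s
    by (simp add: set_lebesgue_integral_def)
  \<comment> \<open>The integrals of the norms are the terms of the binomial series of
    \<open>(1 - norm (1 - w)) powr (- Re s)\<close> times Gamma (Re s), which converges since |1 -
    w| < 1.\<close>
  have sum_norm: "summable (\<lambda>n. LBINT u. norm (f n u))"
  proof -
    have "(\<lambda>n. (- Re s gchoose n) * (- norm (1 - w)) ^ n) sums (1 + (- norm (1 - w))) powr (- Re s)"
      using w by (intro gen_binomial_real) (simp add: norm_minus_commute)
    then have "summable (\<lambda>n. Gamma (Re s) * ((- Re s gchoose n) * (- norm (1 - w)) ^ n))"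
      by (intro summable_mult) (simp add: sums_iff)
    moreover have "Gamma (Re s) * ((- Re s gchoose n) * (- norm (1 - w)) ^ n) = norm (1 - w) ^ n / fact n * Gamma (Re s + n)" for n
    proof -
      have "Gamma (Re s + n) = pochhammer (Re s) n * Gamma (Re s)"
        using pochhammer_Gamma[OF nsr, of n] Gamma_real_pos[OF s] by simp
      moreover have "(- 1) ^ n * (- norm (1 - w)) ^ n = norm (1 - w) ^ n"
        by (simp flip: power_mult_distrib)
      ultimately show ?thesis by (simp add: gbinomial_pochhammer field_simps)
    qed
    ultimately show ?thesis by (simp add: int_norm)
  qed
  have sum_ae: "AE u in lborel. summable (\<lambda>n. norm (f n u))"
  proof (intro AE_I2)
    fix u :: real
    have "summable (\<lambda>n. norm (((1 - w) * of_real u) ^ n /\<^sub>R fact n))"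
      by (rule summable_norm_exp)
    then have "summable (\<lambda>n. norm (indicator {0<..} u *\<^sub>R (of_real (exp (- u)) * rpow (s - 1) u)) * norm (((1 - w) * of_real u) ^ n /\<^sub>R fact n))"
      by (rule summable_mult)
    then show "summable (\<lambda>n. norm (f n u))"
      unfolding f_eq by (simp add: norm_mult norm_divide norm_power field_simps)
  qed
  have "integrable lborel (\<lambda>u. \<Sum>n. f n u)"
    by (rule integrable_suminf[OF f_int sum_ae sum_norm])
  then show "set_integrable lborel {0<..} (\<lambda>u. exp (- w * of_real u) * rpow (s - 1) u)"
    using f_sums by (simp add: set_integrable_def sums_iff)
  have "(\<lambda>n. LBINT u. f n u) sums (LBINT u. (\<Sum>n. f n u))"
    by (rule sums_integral[OF f_int sum_ae sum_norm])
  then have 1: "(\<lambda>n. LBINT u. f n u) sums (LBINT u:{0<..}. exp (- w * of_real u) * rpow (s - 1) u)"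
    using f_sums by (simp add: set_lebesgue_integral_def sums_iff)
  have "(\<lambda>n. (- s gchoose n) * (w - 1) ^ n) sums (1 + (w - 1)) powr (- s)"
    using w by (intro gen_binomial_complex)
  then have "(\<lambda>n. Gamma s * ((- s gchoose n) * (w - 1) ^ n)) sums (Gamma s * w powr (- s))"
    by (intro sums_mult) simp
  \<comment> \<open>Integrating the n-th term gives Gamma (s + n), that is Gamma s times the rising
    factorial of s, and up to the sign (-1)^n this over n! is the binomial coefficient of -
    s.\<close>
  moreover have "Gamma s * ((- s gchoose n) * (w - 1) ^ n) = (LBINT u. f n u)" for n
  proof -
    have "Gamma (s + of_nat n) = pochhammer s n * Gamma s"
      using pochhammer_Gamma[OF ns, of n] ns by (simp add: Gamma_eq_zero_iff)
    moreover have "(- 1) ^ n * (w - 1) ^ n = (1 - w) ^ n"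
      by (simp flip: power_mult_distrib)
    moreover have "(LBINT u. f n u) = (1 - w) ^ n / fact n * Gamma (s + of_nat n)"
    proof -
      have "f n = (\<lambda>u. (1 - w) ^ n / fact n * (indicator {0<..} u *\<^sub>R (of_real (exp (- u)) * rpow (s + of_nat n - 1) u)))"
        by (rule ext) (simp add: f_def)
      then have "(LBINT u. f n u) = (1 - w) ^ n / fact n * (LBINT u:{0<..}. of_real (exp (- u)) * rpow (s + of_nat n - 1) u)"
        unfolding set_lebesgue_integral_def by (metis integral_mult_right_zero)
      then show ?thesis
        using Gamma_integral_rpow(2)[of "s + of_nat n"] s by simp
    qed
    ultimately show ?thesis by (simp add: gbinomial_pochhammer field_simps)
  qed
  ultimately have "(\<lambda>n. LBINT u. f n u) sums (Gamma s * w powr (- s))" by simp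
  with 1 show "(LBINT u:{0<..}. exp (- w * of_real u) * rpow (s - 1) u) = Gamma s * w powr (- s)"
    by (rule sums_unique2)
qed

text \<open>Every z of the right half-plane is a positive multiple of a point of the unit disc about
  1, and the substitution r = u / a carries the local formula over.\<close>

lemma laplace_rpow:
  assumes s: "Re s > 0" and z: "Re z > 0"
  shows "set_integrable lborel {0<..} (\<lambda>r. exp (- z * of_real r) * rpow (s - 1) r)"
    and "(LBINT r:{0<..}. exp (- z * of_real r) * rpow (s - 1) r) = Gamma s * z powr (- s)"
proof -
  \<comment> \<open>With this radius |z - a|^2 = a^2 - |z|^2 < a^2, so z lies in the open disc of
    radius a about a.\<close>
  define a where "a = (norm z)\<^sup>2 / Re z"
  have "z \<noteq> 0" using z by auto
  then have a: "a > 0" using z by (simp add: a_def)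
  define w where "w = z / of_real a"
  have w: "norm (w - 1) < 1"
  proof -
    have "(norm (z - of_real a))\<^sup>2 = (norm z)\<^sup>2 - 2 * a * Re z + a\<^sup>2"
      unfolding cmod_power2 by (simp add: power2_eq_square algebra_simps)
    also have "\<dots> = a\<^sup>2 - (norm z)\<^sup>2" using z by (simp add: a_def)
    also have "\<dots> < a\<^sup>2" using z by auto
    finally have "norm (z - of_real a) < a" using a by (simp add: power2_less_imp_less)
    moreover have "w - 1 = (z - of_real a) / of_real a" using a by (simp add: w_def field_simps)
    ultimately show ?thesis using a by (simp add: norm_divide)
  qed
  have zw: "z = of_real a * w" using a by (simp add: w_def)
  define g where "g r = indicator {0<..} r *\<^sub>R (exp (- z * of_real r) * rpow (s - 1) r)" for r :: real
  have g: "g (0 + (1 / a) * u) = rpow (1 - s) a * (indicator {0<..} u *\<^sub>R (exp (- w * of_real u) * rpow (s - 1) u))" for u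
  proof (cases "u > 0")
    case True
    then have "rpow (s - 1) u = rpow (s - 1) a * rpow (s - 1) (u / a)"
      using rpow_mult_real[of a "u / a"] a by simp
    moreover have "rpow (1 - s) a * rpow (s - 1) a = 1"
      by (simp flip: rpow_add) (simp add: rpow_def)
    ultimately have "rpow (s - 1) (u / a) = rpow (1 - s) a * rpow (s - 1) u"
      by (simp add: mult.assoc[symmetric])
    then show ?thesis using True a by (simp add: g_def w_def)
  next
    case False
    then show ?thesis using a by (simp add: g_def zero_less_divide_iff)
  qed
  have "integrable lborel (\<lambda>u. g (0 + (1 / a) * u))"
    unfolding g using laplace_rpow_near_1(1)[OF s w]
    unfolding set_integrable_def by (rule integrable_mult_right)
  then have "integrable lborel g"
    using a by (subst (asm) lborel_integrable_real_affine_iff) auto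
  then show "set_integrable lborel {0<..} (\<lambda>r. exp (- z * of_real r) * rpow (s - 1) r)"
    by (simp add: g_def[abs_def] set_integrable_def)
  have "(LBINT r:{0<..}. exp (- z * of_real r) * rpow (s - 1) r) = (LBINT r. g r)"
    by (simp add: g_def set_lebesgue_integral_def)
  also have "\<dots> = (1 / a) *\<^sub>R (LBINT u. g (0 + (1 / a) * u))"
    using a by (subst lborel_integral_real_affine[of "1 / a" _ 0]) auto
  also have "(LBINT u. g (0 + (1 / a) * u)) = rpow (1 - s) a * (Gamma s * w powr (- s))"
    unfolding g integral_mult_right_zero
    by (simp only: laplace_rpow_near_1(2)[OF s w, unfolded set_lebesgue_integral_def])
  also have "(1 / a) *\<^sub>R (rpow (1 - s) a * (Gamma s * w powr (- s))) = Gamma s * z powr (- s)"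
  proof -
    have "w \<noteq> 0" using w by auto
    \<comment> \<open>The factor a is positive, so the principal logarithm of the product is the sum
      of the logarithms.\<close>
    have "z powr (- s) = exp (- s * (of_real (ln a) + Ln w))"
      using \<open>w \<noteq> 0\<close> a by (simp add: zw powr_def Ln_times_of_real Ln_of_real)
    also have "\<dots> = rpow (- s) a * w powr (- s)"
      using \<open>w \<noteq> 0\<close> by (simp add: rpow_def powr_def ring_distribs exp_add exp_diff exp_minus field_simps)
    also have "rpow (- s) a = rpow (1 - s) a / of_real a"
      using rpow_add[of "- s" 1 a] rpow_of_nat[OF a, of 1] a by (simp add: field_simps)
    finally show ?thesis by (simp add: scaleR_conv_of_real field_simps)
  qed
  finally show "(LBINT r:{0<..}. exp (- z * of_real r) * rpow (s - 1) r) = Gamma s * z powr (- s)" .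
qed

section \<open>Bounds for the exponential on the closed right half-plane\<close>

lemma norm_exp_minus_le_1:
  fixes w :: complex
  shows "Re w \<ge> 0 \<Longrightarrow> norm (exp (- w)) \<le> 1"
  by simp

lemma norm_exp_minus_diff_1_le:
  fixes w :: complex
  assumes "Re w \<ge> 0"
  shows "norm (exp (- w) - 1) \<le> norm w"
proof -
  have "norm (exp (- w) - exp (- 0)) \<le> 1 * norm (w - 0)"
  proof (rule field_differentiable_bound)
    show "convex {u. 0 \<le> Re u}" by (rule convex_halfspace_Re_ge)
    show "((\<lambda>w. exp (- w)) has_field_derivative - exp (- u)) (at u within {u. 0 \<le> Re u})" for u :: complex
      by (auto intro!: derivative_eq_intros)
  qed (use assms in auto)
  then show ?thesis by simp
qed

lemma norm_exp_minus_diff_1_plus_le: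
  fixes w :: complex
  assumes "Re w \<ge> 0"
  shows "norm (exp (- w) - 1 + w) \<le> (norm w)\<^sup>2"
proof -
  \<comment> \<open>On this convex set the first-order bound keeps the derivative 1 - exp (- u)
    below |u| \<le> |w|, which produces the square.\<close>
  let ?S = "{u. 0 \<le> Re u} \<inter> cball 0 (norm w)"
  have "norm ((exp (- w) - 1 + w) - (exp (- 0) - 1 + 0)) \<le> norm w * norm (w - 0)"
  proof (rule field_differentiable_bound)
    show "convex ?S" by (intro convex_Int convex_halfspace_Re_ge convex_cball)
    show "((\<lambda>w. exp (- w) - 1 + w) has_field_derivative - exp (- u) + 1) (at u within ?S)" for u :: complex
      by (auto intro!: derivative_eq_intros)
    show "norm (- exp (- u) + 1) \<le> norm w" if "u \<in> ?S" for u
      using that norm_exp_minus_diff_1_le[of u] by (auto simp: norm_minus_commute)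
  qed (use assms in auto)
  then show ?thesis by (simp add: power2_eq_square)
qed

lemma set_integrable_powr_lborel:
  fixes a :: real
  shows "a > -1 \<Longrightarrow> set_integrable lborel {0<..1} (\<lambda>r. r powr a)"
    and "a < -1 \<Longrightarrow> set_integrable lborel {1..} (\<lambda>r. r powr a)"
proof -
  assume "a > -1"
  then have "(\<lambda>r. r powr a) absolutely_integrable_on {0<..1}"
    by (intro nonnegative_absolutely_integrable_1 integrable_on_powr_from_0') auto
  then show "set_integrable lborel {0<..1} (\<lambda>r. r powr a)"
    by (subst (asm) set_integrable_lborel_iff_lebesgue) auto
next
  assume "a < -1"
  then have "(\<lambda>r. r powr a) absolutely_integrable_on {1..}"
    using has_integral_powr_to_inf[of a 1] has_integral_integrable
    by (intro nonnegative_absolutely_integrable_1) auto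
  then show "set_integrable lborel {1..} (\<lambda>r. r powr a)"
    by (subst (asm) set_integrable_lborel_iff_lebesgue) auto
qed

text \<open>Near 0 the bound |z| r leaves the exponent Re s > -1; at infinity the bound 2 leaves Re
  s - 1 < -1. Subtracting 1 is what makes the strip left of 0 accessible.\<close>

lemma set_integrable_exp_diff_1_rpow:
  assumes s: "-1 < Re s" "Re s < 0" and z: "Re z > 0"
  shows "set_integrable lborel {0<..} (\<lambda>r. (exp (- z * of_real r) - 1) * rpow (s - 1) r)"
proof -
  define D where "D r = norm z * (indicator {0<..1} r *\<^sub>R r powr (Re s)) + 2 * (indicator {1..} r *\<^sub>R r powr (Re s - 1))" for r
  have "integrable lborel D"
    unfolding D_def using set_integrable_powr_lborel(1)[of "Re s"] set_integrable_powr_lborel(2)[of "Re s - 1"] s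
    unfolding set_integrable_def by (intro Bochner_Integration.integrable_add integrable_mult_right) auto
  then show ?thesis unfolding set_integrable_def
  proof (rule Bochner_Integration.integrable_bound)
    show "AE r in lborel. norm (indicator {0<..} r *\<^sub>R ((exp (- z * of_real r) - 1) * rpow (s - 1) r)) \<le> norm (D r)"
    proof (intro AE_I2)
      fix r :: real
      show "norm (indicator {0<..} r *\<^sub>R ((exp (- z * of_real r) - 1) * rpow (s - 1) r)) \<le> norm (D r)"
      proof (cases "r > 0")
        case True
        have "0 \<le> D r" by (simp add: D_def)
        have "norm (exp (- z * of_real r) - 1) * r powr (Re s - 1) \<le> D r"
        proof (cases "r \<le> 1")
          case True
          have "norm (exp (- z * of_real r) - 1) \<le> norm z * r"
            using norm_exp_minus_diff_1_le[of "z * of_real r"] z \<open>r > 0\<close> by (simp add: norm_mult)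
          then have "norm (exp (- z * of_real r) - 1) * r powr (Re s - 1) \<le> norm z * r * r powr (Re s - 1)"
            by (rule mult_right_mono) simp
          also have "\<dots> = norm z * r powr (Re s)"
            using \<open>r > 0\<close> by (simp add: powr_diff)
          also have "\<dots> \<le> D r" using True \<open>r > 0\<close> by (simp add: D_def)
          finally show ?thesis .
        next
          case False
          have "norm (exp (- z * of_real r) - 1) \<le> norm (exp (- (z * of_real r))) + 1"
            using norm_triangle_ineq4[of "exp (- z * of_real r)" 1] by simp
          also have "\<dots> \<le> 2" using norm_exp_minus_le_1[of "z * of_real r"] z \<open>r > 0\<close> by simp
          finally have "norm (exp (- z * of_real r) - 1) * r powr (Re s - 1) \<le> 2 * r powr (Re s - 1)"
            by (rule mult_right_mono) simp
          also have "\<dots> \<le> D r" using False by (simp add: D_def)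
          finally show ?thesis .
        qed
        then show ?thesis using \<open>0 \<le> D r\<close> True by (simp add: norm_mult norm_rpow)
      qed simp
    qed
  qed measurable
qed

lemma rpow_has_vector_derivative:
  assumes "r > 0"
  shows "(rpow s has_vector_derivative s * rpow (s - 1) r) (at r)"
proof -
  have "rpow (s - 1) r = rpow s r / of_real r"
    using rpow_add[of "s - 1" 1 r] rpow_of_nat[OF assms, of 1] assms by (simp add: field_simps)
  moreover have "((\<lambda>r. s * of_real (ln r)) has_vector_derivative s * of_real (1 / r)) (at r)"
    by (intro has_vector_derivative_mult_right has_vector_derivative_of_real DERIV_ln_divide assms)
  from field_vector_diff_chain_at[OF this DERIV_exp]
  have "(rpow s has_vector_derivative s * of_real (1 / r) * rpow s r) (at r)"
    by (simp add: o_def rpow_def[abs_def])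
  ultimately show ?thesis by (simp add: divide_inverse mult_ac)
qed

text \<open>Integration by parts. The product \<open>F\<close> of exp (- z r) - 1 and r to the power
  s vanishes at both ends in this strip, so s times the integral is z times the Laplace integral at
  s + 1, and Gamma (s + 1) = s Gamma s removes the factor s.\<close>

lemma laplace_exp_diff_1_rpow:
  assumes s: "-1 < Re s" "Re s < 0" and z: "Re z > 0"
  shows "(LBINT r:{0<..}. (exp (- z * of_real r) - 1) * rpow (s - 1) r) = Gamma s * z powr (- s)"
proof -
  define F where "F r = (exp (- z * of_real r) - 1) * rpow s r" for r :: real
  define f where "f r = s * ((exp (- z * of_real r) - 1) * rpow (s - 1) r) - z * (exp (- z * of_real r) * rpow s r)" for r :: real
  have "s \<noteq> 0" "z \<noteq> 0" using s z by auto
  have int1: "set_integrable lborel {0<..} (\<lambda>r. exp (- z * of_real r) * rpow s r)"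
    and val1: "(LBINT r:{0<..}. exp (- z * of_real r) * rpow s r) = Gamma (s + 1) * z powr (- (s + 1))"
    using laplace_rpow[of "s + 1" z] s z by auto
  have int2: "set_integrable lborel {0<..} (\<lambda>r. (exp (- z * of_real r) - 1) * rpow (s - 1) r)"
    by (rule set_integrable_exp_diff_1_rpow[OF s z])
  have f_int: "set_integrable lborel {0<..} f"
    unfolding f_def by (intro set_integral_diff set_integrable_mult_right int1 int2)
  have norm_F: "norm (F r) = norm (exp (- (z * of_real r)) - 1) * r powr (Re s)" if "r > 0" for r
    using that by (simp add: F_def norm_mult norm_rpow)
  have "(LBINT r=0..\<infinity>. f r) = 0 - 0"
  proof (rule interval_integral_FTC_integrable)
    show "(F has_vector_derivative f r) (at r)" if "0 < ereal r" for r
    proof -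
      have "r > 0" using that by simp
      have "((\<lambda>r. exp (- z * of_real r) - 1) has_vector_derivative - z * exp (- z * of_real r)) (at r)"
      proof -
        have "((\<lambda>r. - z * of_real r) has_vector_derivative - z * of_real 1) (at r)"
          by (intro has_vector_derivative_mult_right has_vector_derivative_of_real DERIV_ident)
        from field_vector_diff_chain_at[OF this DERIV_exp]
        show ?thesis by (simp add: o_def has_vector_derivative_diff_const)
      qed
      from has_vector_derivative_mult[OF this rpow_has_vector_derivative[OF \<open>r > 0\<close>, of s]]
      show ?thesis unfolding F_def[abs_def] f_def by (simp add: algebra_simps)
    qed
    show "isCont f r" if "0 < ereal r" for r
      using that unfolding f_def rpow_def by (intro continuous_intros) auto
    show "set_integrable lborel (einterval 0 \<infinity>) f"
      using f_int by (simp add: einterval_def greaterThan_def)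
    have "(F \<longlongrightarrow> 0) (at_right 0)"
    proof (rule Lim_null_comparison)
      show "\<forall>\<^sub>F r in at_right 0. norm (F r) \<le> norm z * r powr (Re s + 1)"
        using eventually_at_right_less[of "0::real"]
      proof eventually_elim
        case (elim r)
        have "norm (F r) \<le> (norm z * r) * r powr (Re s)"
          unfolding norm_F[OF elim] using norm_exp_minus_diff_1_le[of "z * of_real r"] z elim
          by (intro mult_right_mono) (auto simp: norm_mult)
        then show ?case using elim by (simp add: powr_add mult_ac)
      qed
      have "((\<lambda>r. norm z * r powr (Re s + 1)) \<longlongrightarrow> norm z * 0) (at_right (0::real))"
        using s by (intro tendsto_mult tendsto_const tendsto_zero_powrI[where b = "Re s + 1"] tendsto_ident_at)
          (auto intro: eventually_mono[OF eventually_at_right_less])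
      then show "((\<lambda>r. norm z * r powr (Re s + 1)) \<longlongrightarrow> 0) (at_right (0::real))" by simp
    qed
    then show "((F \<circ> real_of_ereal) \<longlongrightarrow> 0) (at_right 0)"
      by (simp add: zero_ereal_def ereal_tendsto_simps1)
    have "(F \<longlongrightarrow> 0) at_top"
    proof (rule Lim_null_comparison)
      show "\<forall>\<^sub>F r in at_top. norm (F r) \<le> 2 * r powr (Re s)"
        using eventually_gt_at_top[of "0::real"]
      proof eventually_elim
        case (elim r)
        have "norm (exp (- (z * of_real r)) - 1) \<le> norm (exp (- (z * of_real r))) + 1"
          using norm_triangle_ineq4[of "exp (- (z * of_real r))" 1] by simp
        also have "\<dots> \<le> 2" using norm_exp_minus_le_1[of "z * of_real r"] z elim by simp
        finally show ?case unfolding norm_F[OF elim] by (rule mult_right_mono) simp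
      qed
      have "((\<lambda>r. 2 * r powr (Re s)) \<longlongrightarrow> 2 * 0) (at_top :: real filter)"
        using s by (intro tendsto_mult tendsto_const tendsto_neg_powr filterlim_ident) auto
      then show "((\<lambda>r. 2 * r powr (Re s)) \<longlongrightarrow> 0) (at_top :: real filter)" by simp
    qed
    then show "((F \<circ> real_of_ereal) \<longlongrightarrow> 0) (at_left \<infinity>)"
      by (simp add: ereal_tendsto_simps1)
  qed auto
  moreover have "(LBINT r=0..\<infinity>. f r) = (LBINT r:{0<..}. f r)"
    by (simp add: interval_lebesgue_integral_def einterval_def greaterThan_def)
  ultimately have "0 = (LBINT r:{0<..}. f r)" by simp
  also have "\<dots> = s * (LBINT r:{0<..}. (exp (- z * of_real r) - 1) * rpow (s - 1) r)
      - z * (LBINT r:{0<..}. exp (- z * of_real r) * rpow s r)"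
    unfolding f_def
    using set_integral_diff(2)[OF set_integrable_mult_right[of s, OF int2] set_integrable_mult_right[of z, OF int1]]
    by (simp only: set_integral_mult_right)
  finally have eq: "s * (LBINT r:{0<..}. (exp (- z * of_real r) - 1) * rpow (s - 1) r)
      = z * (LBINT r:{0<..}. exp (- z * of_real r) * rpow s r)"
    by simp
  have "Gamma (s + 1) = s * Gamma s"
  proof (rule Gamma_plus1)
    show "s \<notin> \<int>\<^sub>\<le>\<^sub>0" using s by (auto elim!: nonpos_Ints_cases)
  qed
  then have "z * (LBINT r:{0<..}. exp (- z * of_real r) * rpow s r) = s * (Gamma s * z powr (- s))"
    using val1 \<open>z \<noteq> 0\<close> by (simp add: powr_diff)
  with eq show ?thesis using \<open>s \<noteq> 0\<close> by simp
qed

subsection \<open>Integration against a measure with given tail\<close>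

text \<open>Fubini needs this because finiteness is known only away from 0, on the rays that start
  at 1 / (n + 1).\<close>

lemma sigma_finite_measure_on_Ioi:
  fixes \<phi> :: "real measure"
  assumes sets: "sets \<phi> = sets (restrict_space borel {0<..})"
    and tail: "\<And>r. r > 0 \<Longrightarrow> emeasure \<phi> {r<..} < \<infinity>"
  shows "sigma_finite_measure \<phi>"
proof
  let ?A = "range (\<lambda>n. {1 / real (Suc n)<..})"
  have "space \<phi> = {0<..}"
    using sets_eq_imp_space_eq[OF sets] by (simp add: space_restrict_space)
  moreover have "\<Union> ?A = {0<..}"
  proof (intro equalityI subsetI)
    fix x :: real assume "x \<in> {0<..}"
    then obtain n where "inverse (real (Suc n)) < x" using reals_Archimedean by auto
    then show "x \<in> \<Union> ?A" by (auto simp: divide_inverse)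
  next
    fix x :: real assume "x \<in> \<Union> ?A"
    then obtain n where "1 / real (Suc n) < x" by auto
    moreover have "0 < 1 / real (Suc n)" by simp
    ultimately show "x \<in> {0<..}" by (metis greaterThan_iff less_trans)
  qed
  moreover have "?A \<subseteq> sets \<phi>"
    unfolding sets by (auto simp: sets_restrict_space_iff)
  moreover have "emeasure \<phi> a \<noteq> \<infinity>" if "a \<in> ?A" for a
  proof -
    from that obtain n where a: "a = {1 / real (Suc n)<..}" by blast
    have "emeasure \<phi> {1 / real (Suc n)<..} < \<infinity>" by (rule tail) simp
    then show ?thesis unfolding a by (rule less_imp_neq)
  qed
  moreover have "countable ?A" by simp
  ultimately show "\<exists>A. countable A \<and> A \<subseteq> sets \<phi> \<and> \<Union> A = space \<phi> \<and> (\<forall>a\<in>A. emeasure \<phi> a \<noteq> \<infinity>)"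
    by metis
qed

text \<open>Layer-cake formula: integrate h over the region 0 < r < y in both orders. For fixed r
  the measure of the y above r is the tail at r.\<close>

lemma integral_wrt_tail:
  fixes \<phi> :: "real measure" and h :: "real \<Rightarrow> complex"
  assumes sets: "sets \<phi> = sets (restrict_space borel {0<..})"
    and tail: "\<And>r. r > 0 \<Longrightarrow> emeasure \<phi> {r<..} = ennreal (T r)" "\<And>r. r > 0 \<Longrightarrow> T r \<ge> 0"
    and [measurable]: "h \<in> borel_measurable borel"
    and int: "set_integrable lborel {0<..} (\<lambda>r. T r *\<^sub>R h r)"
  shows "integrable \<phi> (\<lambda>y. LBINT r:{0<..<y}. h r)"
    and "(\<integral>y. (LBINT r:{0<..<y}. h r) \<partial>\<phi>) = (LBINT r:{0<..}. T r *\<^sub>R h r)"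
proof -
  have space: "space \<phi> = {0<..}"
    using sets_eq_imp_space_eq[OF sets] by (simp add: space_restrict_space)
  have "sigma_finite_measure \<phi>"
    using tail by (intro sigma_finite_measure_on_Ioi[OF sets]) (simp add: less_top)
  then interpret pair_sigma_finite lborel \<phi>
    by (intro pair_sigma_finite.intro lborel.sigma_finite_measure_axioms)
  have [measurable]: "(\<lambda>y. y) \<in> borel_measurable \<phi>"
    by (subst measurable_cong_sets[OF sets refl]) (intro measurable_restrict_space1, simp)
  have [measurable]: "{r<..} \<in> sets \<phi>" if "r > 0" for r
    using that unfolding sets by (auto simp: sets_restrict_space_iff)
  define f where "f r y = (if 0 < r \<and> r < y then h r else 0)" for r y :: real
  have [measurable]: "case_prod f \<in> borel_measurable (lborel \<Otimes>\<^sub>M \<phi>)"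
    unfolding f_def by measurable
  have f_eq: "f r y = indicator {0<..} r *\<^sub>R (indicator {r<..} y *\<^sub>R h r)" for r y
    by (auto simp: f_def indicator_def)
  have ind: "integrable \<phi> (\<lambda>y. indicat_real {r<..} y)" "(\<integral>y. indicat_real {r<..} y \<partial>\<phi>) = T r" if "r > 0" for r
  proof -
    show "integrable \<phi> (\<lambda>y. indicat_real {r<..} y)"
      using that tail by (intro integrable_real_indicator) auto
    have "{r<..} \<inter> space \<phi> = {r<..}" using that by (auto simp: space)
    then show "(\<integral>y. indicat_real {r<..} y \<partial>\<phi>) = T r"
      using that tail by (simp add: measure_def)
  qed
  have f_int1: "integrable \<phi> (\<lambda>y. f r y)" for r
    unfolding f_eq using ind(1) by (cases "r > 0") auto
  have f_val: "(\<integral>y. f r y \<partial>\<phi>) = indicator {0<..} r *\<^sub>R (T r *\<^sub>R h r)" for r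
    unfolding f_eq using ind by (cases "r > 0") auto
  have f_norm: "(\<integral>y. norm (f r y) \<partial>\<phi>) = norm (indicator {0<..} r *\<^sub>R (T r *\<^sub>R h r))" for r
  proof (cases "r > 0")
    case True
    have "norm (f r y) = indicat_real {r<..} y * norm (h r)" for y
      using True by (simp add: f_eq)
    then show ?thesis using True ind[OF True] tail(2)[OF True] by simp
  qed (simp add: f_def)
  have f_int: "integrable (lborel \<Otimes>\<^sub>M \<phi>) (case_prod f)"
  proof (rule Fubini_integrable)
    show "integrable lborel (\<lambda>r. \<integral>y. norm (case_prod f (r, y)) \<partial>\<phi>)"
      using integrable_norm[OF int[unfolded set_integrable_def]] by (simp only: prod.case f_norm)
    show "AE r in lborel. integrable \<phi> (\<lambda>y. case_prod f (r, y))"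
      using f_int1 by simp
  qed measurable
  have inner: "(LBINT r. f r y) = (LBINT r:{0<..<y}. h r)" for y
    unfolding set_lebesgue_integral_def
    by (intro Bochner_Integration.integral_cong) (auto simp: f_def indicator_def)
  show "integrable \<phi> (\<lambda>y. LBINT r:{0<..<y}. h r)"
    using integrable_snd[OF f_int] by (simp add: inner)
  show "(\<integral>y. (LBINT r:{0<..<y}. h r) \<partial>\<phi>) = (LBINT r:{0<..}. T r *\<^sub>R h r)"
    using Fubini_integral[OF f_int] by (simp add: inner f_val set_lebesgue_integral_def)
qed

section \<open>Domination of the compensated exponentials by their value at z = 1\<close>

lemma one_minus_exp_ge:
  fixes y :: real
  assumes "y \<ge> 0"
  shows "y / (1 + y) \<le> 1 - exp (- y)"
proof -
  have "exp (- y) \<le> 1 / (1 + y)"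
    using exp_ge_add_one_self[of y] assms by (simp add: exp_minus field_simps)
  moreover have "y / (1 + y) = 1 - 1 / (1 + y)" using assms by (simp add: field_simps)
  ultimately show ?thesis by simp
qed

text \<open>The left side behaves like y^2 near 0 and like y at infinity, so it bridges the two
  estimates of the compensated exponential.\<close>

lemma exp_minus_1_plus_ge:
  fixes y :: real
  assumes "y \<ge> 0"
  shows "y\<^sup>2 / (2 * (1 + y)) \<le> exp (- y) - 1 + y"
proof -
  define f where "f y = exp (- y) - 1 + y - y\<^sup>2 / (2 * (1 + y))" for y :: real
  have "f 0 \<le> f y"
  proof (rule DERIV_nonneg_imp_nondecreasing[OF assms])
    fix x :: real assume x: "0 \<le> x" "x \<le> y"
    \<comment> \<open>In terms of q the quotient has derivative (1 - q^2) / 2, while 1 - exp (- x)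
      \<ge> 1 - q; their comparison is (1 - q)^2 \<ge> 0.\<close>
    define q where "q = 1 / (1 + x)"
    have "(f has_real_derivative (- exp (- x) + 1 - (2 * x * (2 * (1 + x)) - x\<^sup>2 * 2) / (2 * (1 + x))\<^sup>2)) (at x)"
      unfolding f_def using x by (auto intro!: derivative_eq_intros simp: power2_eq_square)
    also have "(2 * x * (2 * (1 + x)) - x\<^sup>2 * 2) / (2 * (1 + x))\<^sup>2 = (1 - q\<^sup>2) / 2"
    proof -
      have num: "2 * x * (2 * (1 + x)) - x\<^sup>2 * 2 = 2 * ((1 + x)\<^sup>2 - 1)"
        by (simp add: power2_eq_square algebra_simps)
      have "(1 + x)\<^sup>2 \<noteq> 0" using x by simp
      then show ?thesis
        unfolding num q_def power_mult_distrib power_divide by (simp add: diff_divide_distrib)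
    qed
    finally have "(f has_real_derivative (- exp (- x) + 1 - (1 - q\<^sup>2) / 2)) (at x)" .
    moreover have "exp (- x) \<le> q"
      using one_minus_exp_ge[of x] x by (simp add: q_def field_simps)
    moreover have "1 - (1 - q\<^sup>2) / 2 \<ge> q"
      using sum_squares_bound[of 1 q] by (simp add: field_simps)
    ultimately have "(f has_real_derivative (- exp (- x) + 1 - (1 - q\<^sup>2) / 2)) (at x)"
      and "0 \<le> - exp (- x) + 1 - (1 - q\<^sup>2) / 2" by linarith+
    then show "\<exists>d. (f has_real_derivative d) (at x) \<and> 0 \<le> d" by blast
  qed
  then show ?thesis by (simp add: f_def)
qed

text \<open>The bounds |z| y and 2 are added, the second multiplied by y, to give a single estimate
  by y / (1 + y).\<close>

lemma norm_exp_diff_1_le_real: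
  fixes z :: complex and y :: real
  assumes "Re z \<ge> 0" "y \<ge> 0"
  shows "norm (exp (- z * of_real y) - 1) \<le> (norm z + 2) * (1 - exp (- y))"
proof -
  let ?a = "norm (exp (- z * of_real y) - 1)"
  have 1: "?a \<le> norm z * y"
    using norm_exp_minus_diff_1_le[of "z * of_real y"] assms by (simp add: norm_mult)
  have "?a \<le> norm (exp (- (z * of_real y))) + 1"
    using norm_triangle_ineq4[of "exp (- z * of_real y)" 1] by simp
  also have "\<dots> \<le> 2" using norm_exp_minus_le_1[of "z * of_real y"] assms by simp
  finally have "?a * y \<le> 2 * y" using assms by (intro mult_right_mono) auto
  with 1 have "?a * (1 + y) \<le> (norm z + 2) * y" by (simp add: algebra_simps)
  then have "?a \<le> (norm z + 2) * (y / (1 + y))" using assms by (simp add: pos_le_divide_eq)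
  also have "\<dots> \<le> (norm z + 2) * (1 - exp (- y))"
    using one_minus_exp_ge[OF assms(2)] by (intro mult_left_mono) auto
  finally show ?thesis .
qed

text \<open>The same device with the bounds |z|^2 y^2 and 2 |z| y.\<close>

lemma norm_exp_diff_1_plus_le_real:
  fixes z :: complex and y :: real
  assumes "Re z \<ge> 0" "y \<ge> 0"
  shows "norm (exp (- z * of_real y) - 1 + z * of_real y)
    \<le> 2 * ((norm z)\<^sup>2 + 2 * norm z) * (exp (- y) - 1 + y)"
proof -
  let ?a = "norm (exp (- z * of_real y) - 1 + z * of_real y)" and ?K = "(norm z)\<^sup>2 + 2 * norm z"
  have 1: "?a \<le> (norm z)\<^sup>2 * y\<^sup>2"
    using norm_exp_minus_diff_1_plus_le[of "z * of_real y"] assms by (simp add: norm_mult power_mult_distrib)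
  have "?a \<le> norm (exp (- z * of_real y) - 1) + norm (z * of_real y)"
    by (rule norm_triangle_ineq)
  also have "\<dots> \<le> 2 * norm z * y"
    using norm_exp_minus_diff_1_le[of "z * of_real y"] assms by (simp add: norm_mult mult_ac)
  finally have "?a * y \<le> (2 * norm z * y) * y" using assms by (intro mult_right_mono) auto
  with 1 have "?a * (1 + y) \<le> ?K * y\<^sup>2" by (simp add: algebra_simps power2_eq_square)
  then have "?a \<le> ?K * y\<^sup>2 / (1 + y)" using assms by (simp add: pos_le_divide_eq)
  also have "\<dots> = 2 * ?K * (y\<^sup>2 / (2 * (1 + y)))"
  proof -
    have "k * u / v = 2 * k * (u / (2 * v))" for k u v :: real by simp
    then show ?thesis .
  qed
  also have "\<dots> \<le> 2 * ?K * (exp (- y) - 1 + y)"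
    using exp_minus_1_plus_ge[OF assms(2)] by (intro mult_left_mono) auto
  finally show ?thesis .
qed

subsection \<open>The characteristic exponent\<close>

locale semistable =
  fixes c \<alpha> :: real and \<theta> :: "real \<Rightarrow> real" and \<phi> :: "real measure"
  assumes c: "c > 1" and \<alpha>: "0 < \<alpha>" "\<alpha> < 2" "\<alpha> \<noteq> 1"
    and smooth: "smooth_admissible c \<alpha> \<theta>"
    and levy: "is_levy_measure \<alpha> \<theta> \<phi>"
begin

abbreviation w :: real where "w \<equiv> freq c \<alpha>"

text \<open>Chosen so that r to the power - \<alpha> times the k-th Fourier mode at ln r is
  \<open>rpow (s k - 1) r\<close>; each mode of the tail thus gives a Mellin transform at
  \<open>s k\<close>.\<close>

definition s :: "int \<Rightarrow> complex" where "s k = Complex (1 - \<alpha>) (of_int k * w)"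

definition fcoeff :: "int \<Rightarrow> complex" where "fcoeff k = fourier_coeff w \<theta> k"

definition tail :: "real \<Rightarrow> real" where "tail r = r powr (- \<alpha>) * \<theta> (ln r)"

text \<open>A switch that lets the ranges of \<alpha> below and above 1 share one argument.\<close>

definition compensation :: complex where "compensation = (if \<alpha> < 1 then 0 else 1)"

definition kernel :: "complex \<Rightarrow> real \<Rightarrow> complex" where
  "kernel z r = exp (- z * of_real r) - compensation"

text \<open>At z = - ix this is the integrand of \<open>log_char\<close>. As a function of y it is
  the antiderivative of \<open>- z * kernel z\<close> that vanishes at 0.\<close>

definition compensated :: "complex \<Rightarrow> real \<Rightarrow> complex" where
  "compensated z y = exp (- z * of_real y) - 1 + compensation * z * of_real y"

lemma w_pos: "w > 0"
  using c \<alpha> by (simp add: freq_def)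

lemma period_eq: "2 * pi / w = ln (c powr (1 / \<alpha>))"
  using c \<alpha> by (simp add: freq_def ln_powr)

lemma theta_pos: "\<theta> y > 0"
  using smooth by (auto simp: smooth_admissible_def admissible_def)

lemma theta_periodic: "\<theta> (y + 2 * pi / w) = \<theta> y"
  using smooth by (auto simp: smooth_admissible_def admissible_def period_eq)

lemma theta_continuous: "continuous_on UNIV \<theta>"
  using smooth by (auto simp: smooth_admissible_def)

lemma theta_measurable [measurable]: "\<theta> \<in> borel_measurable borel"
  using theta_continuous by (rule borel_measurable_continuous_onI)

lemma theta_lipschitz: "\<exists>L. L-lipschitz_on UNIV (\<lambda>x. complex_of_real (\<theta> x))"
proof -
  have "2 * pi / w > 0" using w_pos by simp
  moreover have "piecewise_C1 \<theta>" using smooth by (simp add: smooth_admissible_def)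
  ultimately obtain L where "L-lipschitz_on UNIV \<theta>"
    using piecewise_C1_periodic_lipschitz theta_continuous theta_periodic by metis
  then have "L-lipschitz_on UNIV (\<lambda>x. complex_of_real (\<theta> x))"
    unfolding lipschitz_on_def by (simp add: dist_norm flip: of_real_diff)
  then show ?thesis ..
qed

lemma fcoeff_eq: "fcoeff k = cfourier w (\<lambda>x. of_real (\<theta> x)) k"
proof -
  have "continuous_on {0..2 * pi / w} (\<lambda>x. complex_of_real (\<theta> x) * cis (- (of_int k * w * x)))"
    by (intro continuous_intros continuous_on_subset[OF theta_continuous]) auto
  then show ?thesis
    by (simp add: fcoeff_def fourier_coeff_def cfourier_def integral_period_measure cis_conv_exp mult_ac)
qed

lemma theta_has_sum: "((\<lambda>k. fcoeff k * cis (of_int k * w * x)) has_sum of_real (\<theta> x)) UNIV"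
proof -
  obtain L where "L-lipschitz_on UNIV (\<lambda>x. complex_of_real (\<theta> x))" using theta_lipschitz by blast
  from fourier_series_lipschitz[OF w_pos this] show ?thesis
    by (simp add: theta_periodic fcoeff_eq)
qed

lemma fcoeff_powr_summable:
  assumes "b < 1 / 2"
  shows "(\<lambda>k. \<bar>real_of_int k\<bar> powr b * norm (fcoeff k)) summable_on UNIV"
proof -
  obtain L where "L-lipschitz_on UNIV (\<lambda>x. complex_of_real (\<theta> x))" using theta_lipschitz by blast
  from abs_summable_lipschitz_cfourier[OF w_pos this _ assms] show ?thesis
    by (simp add: theta_periodic fcoeff_eq)
qed

lemma fcoeff_abs_summable: "(\<lambda>k. norm (fcoeff k)) summable_on UNIV"
  using has_sum_imp_summable[OF theta_has_sum[of 0]] summable_on_iff_abs_summable_on_complex[of fcoeff UNIV] by simp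

lemma s_powr: "rpow (s k - 1) r = rpow (- of_real \<alpha>) r * cis (of_int k * w * ln r)"
proof -
  have "s k - 1 = - of_real \<alpha> + \<i> * of_real (of_int k * w)"
    by (simp add: s_def complex_eq_iff)
  moreover have "rpow (\<i> * of_real (of_int k * w)) r = cis (of_int k * w * ln r)"
    by (simp add: rpow_def cis_conv_exp mult_ac)
  ultimately show ?thesis by (simp only: rpow_add)
qed

lemma rpow_minus_alpha: "r > 0 \<Longrightarrow> rpow (- of_real \<alpha>) r = of_real (r powr (- \<alpha>))"
  using rpow_of_real[of r "- \<alpha>"] by simp

text \<open>The exponential is the largest value that the argument of z can contribute to
  \<open>z powr (1 - s k)\<close> on the closed right half-plane, where |arg z| \<le> pi /
  2.\<close>

definition majorant :: "int \<Rightarrow> real" where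
  "majorant k = norm (fcoeff k) * norm (Gamma (s k)) * exp (pi * \<bar>of_int k * w\<bar> / 2)"

text \<open>The exponential cancels the decay of Gamma exactly, leaving \<open>|k| powr b\<close>
  times the coefficient with b < 1/2. The Gamma bound is taken from height w on, which covers every
  k except 0; that term is added separately.\<close>

lemma majorant_summable: "majorant summable_on UNIV"
proof -
  obtain K b where K: "K > 0" "0 \<le> b" "b < 1 / 2"
    and bound: "\<And>t. \<bar>t\<bar> \<ge> w \<Longrightarrow> norm (Gamma (Complex (1 - \<alpha>) t)) \<le> K * \<bar>t\<bar> powr b * exp (- pi * \<bar>t\<bar> / 2)"
    using norm_Gamma_vertical_upper_bound[of "1 - \<alpha>" w] \<alpha> w_pos by auto
  have "(\<lambda>k. K * w powr b * (\<bar>real_of_int k\<bar> powr b * norm (fcoeff k))) summable_on (UNIV - {0})"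
    using fcoeff_powr_summable[OF K(3)] by (intro summable_on_cmult_right) (rule summable_on_subset_banach, auto)
  then have "majorant summable_on (UNIV - {0})"
  proof (rule summable_on_comparison_test)
    fix k :: int assume "k \<in> UNIV - {0}"
    then have "\<bar>real_of_int k\<bar> \<ge> 1" by auto
    then have "\<bar>of_int k * w\<bar> \<ge> w" using w_pos mult_right_mono[of 1 "\<bar>real_of_int k\<bar>" w] by (simp add: abs_mult)
    from bound[OF this] have "norm (Gamma (s k)) * exp (pi * \<bar>of_int k * w\<bar> / 2)
       \<le> (K * \<bar>of_int k * w\<bar> powr b * exp (- pi * \<bar>of_int k * w\<bar> / 2)) * exp (pi * \<bar>of_int k * w\<bar> / 2)"
      unfolding s_def by (rule mult_right_mono) simp
    also have "\<dots> = K * \<bar>of_int k * w\<bar> powr b" by (simp add: exp_minus)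
    also have "\<dots> = K * w powr b * \<bar>real_of_int k\<bar> powr b"
      using w_pos by (simp add: abs_mult powr_mult)
    finally have "norm (Gamma (s k)) * exp (pi * \<bar>of_int k * w\<bar> / 2) \<le> K * w powr b * \<bar>real_of_int k\<bar> powr b" .
    from mult_left_mono[OF this, of "norm (fcoeff k)"]
    show "majorant k \<le> K * w powr b * (\<bar>real_of_int k\<bar> powr b * norm (fcoeff k))"
      by (simp add: majorant_def mult_ac)
  qed (simp add: majorant_def)
  from summable_on_union[OF this summable_on_finite[of "{0}"]] show ?thesis by simp
qed

text \<open>Since 1 - s k = \<alpha> - i k w, the modulus of the power is |z| to the power \<alpha>
  times exp (k w arg z).\<close>

lemma norm_term_le:
  assumes "Re z \<ge> 0" "z \<noteq> 0"
  shows "norm (fcoeff k * Gamma (s k) * z powr (1 - s k)) \<le> norm z powr \<alpha> * majorant k"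
proof -
  have "norm (z powr (1 - s k)) = norm z powr \<alpha> * exp (of_int k * w * Im (Ln z))"
    using assms by (simp add: norm_powr_real_powr' powr_def s_def exp_add[symmetric] algebra_simps)
  also have "\<dots> \<le> norm z powr \<alpha> * exp (pi * \<bar>of_int k * w\<bar> / 2)"
  proof -
    have "\<bar>Im (Ln z)\<bar> \<le> pi / 2" using assms Re_Ln_pos_le[of z] by simp
    then have "\<bar>of_int k * w * Im (Ln z)\<bar> \<le> \<bar>of_int k * w\<bar> * (pi / 2)"
      unfolding abs_mult[of "of_int k * w"] by (intro mult_left_mono) auto
    then have "of_int k * w * Im (Ln z) \<le> pi * \<bar>of_int k * w\<bar> / 2"
      using abs_ge_self[of "of_int k * w * Im (Ln z)"] by (simp add: mult.commute)
    then show ?thesis by (intro mult_left_mono) auto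
  qed
  finally have "norm (fcoeff k * Gamma (s k)) * norm (z powr (1 - s k))
      \<le> norm (fcoeff k * Gamma (s k)) * (norm z powr \<alpha> * exp (pi * \<bar>of_int k * w\<bar> / 2))"
    by (rule mult_left_mono) simp
  then show ?thesis by (simp add: majorant_def norm_mult mult_ac)
qed

lemma term_abs_summable:
  assumes "Re z \<ge> 0" "z \<noteq> 0"
  shows "(\<lambda>k. norm (fcoeff k * Gamma (s k) * z powr (1 - s k))) summable_on UNIV"
  using norm_term_le[OF assms]
  by (intro Infinite_Sum.abs_summable_on_comparison_test'[OF summable_on_cmult_right[OF majorant_summable]])

text \<open>The real part 1 - \<alpha> is positive for \<alpha> < 1 and lies strictly between -1 and
  0 for 1 < \<alpha> < 2; these are the ranges of the two Mellin formulas.\<close>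

lemma kernel_mellin:
  assumes "Re z > 0"
  shows "set_integrable lborel {0<..} (\<lambda>r. kernel z r * rpow (s k - 1) r)"
    and "(LBINT r:{0<..}. kernel z r * rpow (s k - 1) r) = Gamma (s k) * z powr (- s k)"
proof -
  have "set_integrable lborel {0<..} (\<lambda>r. kernel z r * rpow (s k - 1) r) \<and>
    (LBINT r:{0<..}. kernel z r * rpow (s k - 1) r) = Gamma (s k) * z powr (- s k)"
  proof (cases "\<alpha> < 1")
    case True
    then show ?thesis using laplace_rpow[of "s k" z] assms by (simp add: kernel_def compensation_def s_def)
  next
    case False
    then have "-1 < Re (s k)" "Re (s k) < 0" using \<alpha> by (auto simp: s_def)
    from set_integrable_exp_diff_1_rpow[OF this assms] laplace_exp_diff_1_rpow[OF this assms]
    show ?thesis using False by (simp add: kernel_def compensation_def)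
  qed
  then show "set_integrable lborel {0<..} (\<lambda>r. kernel z r * rpow (s k - 1) r)"
    and "(LBINT r:{0<..}. kernel z r * rpow (s k - 1) r) = Gamma (s k) * z powr (- s k)" by auto
qed

lemma kernel_measurable [measurable]: "kernel z \<in> borel_measurable borel"
  unfolding kernel_def[abs_def] by measurable

text \<open>Dominated convergence along the symmetric partial sums of the Fourier series of \<theta>
  at ln r.\<close>

lemma kernel_tail:
  assumes z: "Re z > 0"
  shows "set_integrable lborel {0<..} (\<lambda>r. tail r *\<^sub>R kernel z r)"
    and "(LBINT r:{0<..}. tail r *\<^sub>R kernel z r) = (\<Sum>\<^sub>\<infinity>k. fcoeff k * (Gamma (s k) * z powr (- s k)))"
proof -
  define A where "A = (\<Sum>\<^sub>\<infinity>k. norm (fcoeff k))"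
  define f where "f n r = (\<Sum>k\<in>{- int n..int n}. fcoeff k * (indicator {0<..} r *\<^sub>R (kernel z r * rpow (s k - 1) r)))" for n :: nat and r
  have f_eq: "f n r = indicator {0<..} r *\<^sub>R (kernel z r * rpow (- of_real \<alpha>) r) *
      (\<Sum>k\<in>{- int n..int n}. fcoeff k * cis (of_int k * w * ln r))" for n r
    unfolding f_def s_powr by (simp add: sum_distrib_left mult_ac)
  \<comment> \<open>All modes have modulus 1, so one integrable function, the term at index 0 times
    the sum \<open>A\<close> of the coefficient moduli, dominates every partial sum.\<close>
  have bound: "norm (f n r) \<le> A * norm (indicator {0<..} r *\<^sub>R (kernel z r * rpow (s 0 - 1) r))" for n r
  proof -
    have "norm (\<Sum>k\<in>{- int n..int n}. fcoeff k * cis (of_int k * w * ln r)) \<le> (\<Sum>k\<in>{- int n..int n}. norm (fcoeff k))"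
      by (rule order.trans[OF norm_sum]) (simp add: norm_mult)
    also have "\<dots> \<le> A"
      unfolding A_def by (rule finite_sum_le_infsum[OF fcoeff_abs_summable]) auto
    finally show ?thesis
      unfolding f_eq norm_mult[of "_ *\<^sub>R _"] s_powr by (simp add: mult_left_mono mult.commute[of A])
  qed
  have lim: "(\<lambda>n. f n r) \<longlonglongrightarrow> indicator {0<..} r *\<^sub>R (tail r *\<^sub>R kernel z r)" for r
  proof -
    have "(\<lambda>n. \<Sum>k\<in>{- int n..int n}. fcoeff k * cis (of_int k * w * ln r)) \<longlonglongrightarrow> of_real (\<theta> (ln r))"
      using theta_has_sum[of "ln r"] unfolding has_sum_def
      by (rule filterlim_compose[OF _ filterlim_symmetric_int_intervals])
    then have "(\<lambda>n. f n r) \<longlonglongrightarrow> indicator {0<..} r *\<^sub>R (kernel z r * rpow (- of_real \<alpha>) r) * of_real (\<theta> (ln r))"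
      unfolding f_eq by (intro tendsto_intros)
    also have "indicator {0<..} r *\<^sub>R (kernel z r * rpow (- of_real \<alpha>) r) * of_real (\<theta> (ln r))
       = indicator {0<..} r *\<^sub>R (tail r *\<^sub>R kernel z r)"
      by (cases "r > 0") (simp_all add: rpow_minus_alpha tail_def scaleR_conv_of_real)
    finally show ?thesis .
  qed
  have int0: "integrable lborel (\<lambda>r. A * norm (indicator {0<..} r *\<^sub>R (kernel z r * rpow (s 0 - 1) r)))"
    using kernel_mellin(1)[OF z, of 0] unfolding set_integrable_def
    by (intro integrable_mult_right integrable_norm)
  have [measurable]: "tail \<in> borel_measurable borel"
    unfolding tail_def[abs_def] by measurable
  have meas: "f n \<in> borel_measurable lborel" "(\<lambda>r. indicator {0<..} r *\<^sub>R (tail r *\<^sub>R kernel z r)) \<in> borel_measurable lborel" for n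
    unfolding f_def[abs_def] by measurable
  show "set_integrable lborel {0<..} (\<lambda>r. tail r *\<^sub>R kernel z r)"
    unfolding set_integrable_def
    by (rule integrable_dominated_convergence[where s = f, OF meas(2) meas(1) int0]) (use lim bound in auto)
  have "(\<lambda>n. LBINT r. f n r) \<longlonglongrightarrow> (LBINT r. indicator {0<..} r *\<^sub>R (tail r *\<^sub>R kernel z r))"
    by (rule integral_dominated_convergence[where s = f, OF meas(2) meas(1) int0]) (use lim bound in auto)
  moreover have "(LBINT r. f n r) = (\<Sum>k\<in>{- int n..int n}. fcoeff k * (Gamma (s k) * z powr (- s k)))" for n
  proof -
    let ?g = "\<lambda>k r. indicator {0<..} r *\<^sub>R (kernel z r * rpow (s k - 1) r)"
    have i: "integrable lborel (\<lambda>r. fcoeff k * ?g k r)" for k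
      by (rule integrable_mult_right) (rule kernel_mellin(1)[OF z, unfolded set_integrable_def])
    have v: "(LBINT r. fcoeff k * ?g k r) = fcoeff k * (Gamma (s k) * z powr (- s k))" for k
      unfolding integral_mult_right_zero kernel_mellin(2)[OF z, unfolded set_lebesgue_integral_def] ..
    have "(LBINT r. f n r) = (\<Sum>k\<in>{- int n..int n}. LBINT r. fcoeff k * ?g k r)"
      unfolding f_def using i by (rule Bochner_Integration.integral_sum)
    also have "\<dots> = (\<Sum>k\<in>{- int n..int n}. fcoeff k * (Gamma (s k) * z powr (- s k)))"
      unfolding v ..
    finally show ?thesis .
  qed
  moreover have "(\<lambda>n. \<Sum>k\<in>{- int n..int n}. fcoeff k * (Gamma (s k) * z powr (- s k)))
      \<longlonglongrightarrow> (\<Sum>\<^sub>\<infinity>k. fcoeff k * (Gamma (s k) * z powr (- s k)))"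
  proof -
    have "z \<noteq> 0" using z by auto
    have "(\<lambda>k. fcoeff k * Gamma (s k) * z powr (1 - s k)) summable_on UNIV"
      by (rule abs_summable_summable, rule term_abs_summable) (use z \<open>z \<noteq> 0\<close> in auto)
    then have "(\<lambda>k. inverse z * (fcoeff k * Gamma (s k) * z powr (1 - s k))) summable_on UNIV"
      by (rule summable_on_cmult_right)
    moreover have "inverse z * (fcoeff k * Gamma (s k) * z powr (1 - s k)) = fcoeff k * (Gamma (s k) * z powr (- s k))" for k
      using \<open>z \<noteq> 0\<close> by (simp add: powr_diff powr_minus field_simps)
    ultimately have "(\<lambda>k. fcoeff k * (Gamma (s k) * z powr (- s k))) summable_on UNIV" by simp
    from has_sum_infsum[OF this] show ?thesis
      unfolding has_sum_def by (rule filterlim_compose[OF _ filterlim_symmetric_int_intervals])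
  qed
  ultimately have "(LBINT r. indicator {0<..} r *\<^sub>R (tail r *\<^sub>R kernel z r)) = (\<Sum>\<^sub>\<infinity>k. fcoeff k * (Gamma (s k) * z powr (- s k)))"
    using LIMSEQ_unique by force
  then show "(LBINT r:{0<..}. tail r *\<^sub>R kernel z r) = (\<Sum>\<^sub>\<infinity>k. fcoeff k * (Gamma (s k) * z powr (- s k)))"
    unfolding set_lebesgue_integral_def .
qed

lemma compensated_eq_integral:
  assumes "y > 0"
  shows "compensated z y = (LBINT r:{0<..<y}. - z * kernel z r)"
proof -
  have "(LBINT r=ereal 0..ereal y. - z * kernel z r) = compensated z y - compensated z 0"
  proof (rule interval_integral_FTC_finite)
    show "continuous_on {min 0 y..max 0 y} (\<lambda>r. - z * kernel z r)"
      unfolding kernel_def by (intro continuous_intros)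
    show "(compensated z has_vector_derivative - z * kernel z r) (at r within {min 0 y..max 0 y})" for r
    proof -
      have 1: "((\<lambda>r. a * of_real r) has_vector_derivative a * of_real 1) (at r)" for a :: complex
        by (intro has_vector_derivative_mult_right has_vector_derivative_of_real DERIV_ident)
      from field_vector_diff_chain_at[OF 1[of "- z"] DERIV_exp]
      have "((\<lambda>r. exp (- z * of_real r)) has_vector_derivative - z * exp (- z * of_real r)) (at r)"
        by (simp add: o_def)
      from has_vector_derivative_add[OF this 1[of "compensation * z"]]
      have "((\<lambda>r. exp (- z * of_real r) + compensation * z * of_real r) has_vector_derivative - z * kernel z r) (at r)"
        by (simp add: kernel_def algebra_simps)
      then have "((\<lambda>r. (exp (- z * of_real r) + compensation * z * of_real r) - 1) has_vector_derivative - z * kernel z r) (at r)"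
        unfolding has_vector_derivative_diff_const .
      moreover have "compensated z = (\<lambda>r. (exp (- z * of_real r) + compensation * z * of_real r) - 1)"
        by (rule ext) (simp add: compensated_def)
      ultimately have "(compensated z has_vector_derivative - z * kernel z r) (at r)" by (simp only:)
      then show ?thesis by (rule has_vector_derivative_at_within)
    qed
  qed
  moreover have "(LBINT r=ereal 0..ereal y. - z * kernel z r) = (LBINT r:{0<..<y}. - z * kernel z r)"
    using assms by (subst interval_integral_Ioo) auto
  ultimately show ?thesis by (simp add: compensated_def)
qed

lemma sets_levy: "sets \<phi> = sets (restrict_space borel {0<..})"
  using levy by (simp add: is_levy_measure_def)

lemma space_levy: "space \<phi> = {0<..}"
  using sets_eq_imp_space_eq[OF sets_levy] by (simp add: space_restrict_space)

lemma tail_levy: "r > 0 \<Longrightarrow> emeasure \<phi> {r<..} = ennreal (tail r)"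
  using levy by (simp add: is_levy_measure_def tail_def)

lemma tail_nonneg: "tail r \<ge> 0"
  using theta_pos[of "ln r"] by (simp add: tail_def)

text \<open>The layer-cake formula applied to the derivative \<open>- z * kernel z\<close>; its
  factor - z accounts for the sign and raises the exponent from - s k to 1 - s k.\<close>

lemma compensated_right_half_plane:
  assumes z: "Re z > 0"
  shows "integrable \<phi> (compensated z)"
    and "(\<integral>y. compensated z y \<partial>\<phi>) = - (\<Sum>\<^sub>\<infinity>k. fcoeff k * Gamma (s k) * z powr (1 - s k))"
proof -
  have "z \<noteq> 0" using z by auto
  have int: "set_integrable lborel {0<..} (\<lambda>r. tail r *\<^sub>R (- z * kernel z r))"
    using set_integrable_mult_right[of "- z", OF kernel_tail(1)[OF z]]
    by (simp only: mult_scaleR_right)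
  have [measurable]: "(\<lambda>r. - z * kernel z r) \<in> borel_measurable borel" by measurable
  note tailint = integral_wrt_tail[OF sets_levy tail_levy tail_nonneg this int]
  have eq: "compensated z y = (LBINT r:{0<..<y}. - z * kernel z r)" if "y \<in> space \<phi>" for y
    using that compensated_eq_integral[of y z] by (simp add: space_levy)
  show "integrable \<phi> (compensated z)"
    using tailint(1) by (subst Bochner_Integration.integrable_cong[OF refl eq]) auto
  have "(\<integral>y. compensated z y \<partial>\<phi>) = (\<integral>y. (LBINT r:{0<..<y}. - z * kernel z r) \<partial>\<phi>)"
    by (intro Bochner_Integration.integral_cong refl eq)
  also have "\<dots> = (LBINT r:{0<..}. tail r *\<^sub>R (- z * kernel z r))" by (rule tailint(2))
  also have "\<dots> = - z * (LBINT r:{0<..}. tail r *\<^sub>R kernel z r)"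
    by (simp only: mult_scaleR_right[symmetric] set_integral_mult_right)
  also have "\<dots> = - (z * (\<Sum>\<^sub>\<infinity>k. fcoeff k * (Gamma (s k) * z powr (- s k))))"
    by (simp add: kernel_tail(2)[OF z])
  also have "z * (\<Sum>\<^sub>\<infinity>k. fcoeff k * (Gamma (s k) * z powr (- s k)))
      = (\<Sum>\<^sub>\<infinity>k. z * (fcoeff k * (Gamma (s k) * z powr (- s k))))"
    by (rule infsum_cmult_right'[symmetric])
  also have "\<dots> = (\<Sum>\<^sub>\<infinity>k. fcoeff k * Gamma (s k) * z powr (1 - s k))"
    using \<open>z \<noteq> 0\<close> by (intro infsum_cong) (simp add: powr_diff powr_minus field_simps)
  finally show "(\<integral>y. compensated z y \<partial>\<phi>) = - (\<Sum>\<^sub>\<infinity>k. fcoeff k * Gamma (s k) * z powr (1 - s k))" .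
qed

text \<open>A domination uniform over bounded parts of the closed half-plane, imaginary axis
  included, by a function whose integrability is known from the open half-plane. The constant is
  generous so as to serve both ranges of \<alpha>.\<close>

lemma norm_compensated_le:
  assumes "Re z \<ge> 0" "norm z \<le> B" "y \<ge> 0"
  shows "norm (compensated z y) \<le> 2 * (B + 2)\<^sup>2 * norm (compensated 1 y)"
proof -
  have B: "B \<ge> 0" using assms(2) norm_ge_zero[of z] by linarith
  show ?thesis
  proof (cases "\<alpha> < 1")
    case True
    have "norm (compensated 1 y) = 1 - exp (- y)"
    proof -
      have "compensated 1 y = of_real (exp (- y) - 1)"
        using True by (simp add: compensated_def compensation_def exp_of_real[symmetric])
      then have "norm (compensated 1 y) = \<bar>exp (- y) - 1\<bar>" by (simp only: norm_of_real)
      then show ?thesis using assms by simp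
    qed
    moreover have "norm (compensated z y) \<le> (norm z + 2) * (1 - exp (- y))"
      using norm_exp_diff_1_le_real[OF assms(1,3)] True by (simp add: compensated_def compensation_def)
    moreover have "(norm z + 2) * (1 - exp (- y)) \<le> 2 * (B + 2)\<^sup>2 * (1 - exp (- y))"
    proof (rule mult_right_mono)
      have "norm z + 2 \<le> (B + 2) * 1" using assms by simp
      also have "\<dots> \<le> (B + 2) * (2 * (B + 2))" using B by (intro mult_left_mono) auto
      finally show "norm z + 2 \<le> 2 * (B + 2)\<^sup>2" by (simp only: power2_eq_square mult_ac)
    qed (use assms in auto)
    ultimately show ?thesis by simp
  next
    case False
    have nonneg: "0 \<le> exp (- y) - 1 + y" using exp_ge_add_one_self[of "- y"] by simp
    have "norm (compensated 1 y) = exp (- y) - 1 + y"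
    proof -
      have "compensated 1 y = of_real (exp (- y) - 1 + y)"
        using False by (simp add: compensated_def compensation_def exp_of_real[symmetric])
      then have "norm (compensated 1 y) = \<bar>exp (- y) - 1 + y\<bar>" by (simp only: norm_of_real)
      then show ?thesis using nonneg by simp
    qed
    moreover have "norm (compensated z y) \<le> 2 * ((norm z)\<^sup>2 + 2 * norm z) * (exp (- y) - 1 + y)"
      using norm_exp_diff_1_plus_le_real[OF assms(1,3)] False by (simp add: compensated_def compensation_def)
    moreover have "2 * ((norm z)\<^sup>2 + 2 * norm z) * (exp (- y) - 1 + y) \<le> 2 * (B + 2)\<^sup>2 * (exp (- y) - 1 + y)"
    proof (intro mult_right_mono[OF mult_left_mono] nonneg)
      have "(norm z)\<^sup>2 + 2 * norm z \<le> (norm z + 2)\<^sup>2" by (simp add: power2_eq_square algebra_simps)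
      also have "\<dots> \<le> (B + 2)\<^sup>2" using assms by (intro power_mono) auto
      finally show "(norm z)\<^sup>2 + 2 * norm z \<le> (B + 2)\<^sup>2" .
    qed simp
    ultimately show ?thesis by simp
  qed
qed

lemma log_char_eq_compensated: "log_char \<alpha> \<phi> x = (\<integral>y. compensated (- \<i> * of_real x) y \<partial>\<phi>)"
  using \<alpha> by (auto simp: log_char_def compensated_def compensation_def mult_ac intro!: Bochner_Integration.integral_cong)

lemma compensated_measurable [measurable]: "compensated z \<in> borel_measurable \<phi>"
proof -
  have [measurable]: "compensated z \<in> borel_measurable borel"
    unfolding compensated_def[abs_def] by measurable
  show ?thesis
    by (subst measurable_cong_sets[OF sets_levy refl]) (intro measurable_restrict_space1, simp)
qed

lemma log_char_series:
  assumes "x \<noteq> 0"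
  shows "log_char \<alpha> \<phi> x = - (\<Sum>\<^sub>\<infinity>k. fcoeff k * Gamma (s k) * (- \<i> * of_real x) powr (1 - s k))"
proof -
  \<comment> \<open>The segment from 1 - ix to - ix. As x is nonzero, it avoids 0 and the branch
    cut, so every term of the series is continuous up to t = 0.\<close>
  define \<zeta> where "\<zeta> t = Complex t (- x)" for t :: real
  define B where "B = 1 + \<bar>x\<bar>"
  define t where "t n = 1 / real (Suc n)" for n
  let ?f = "\<lambda>k t. fcoeff k * Gamma (s k) * \<zeta> t powr (1 - s k)"
  have \<zeta>: "\<zeta> u \<noteq> 0" "Re (\<zeta> u) = u" "Im (\<zeta> u) = - x" for u
    using assms by (auto simp: \<zeta>_def complex_eq_iff)
  have \<zeta>0: "\<zeta> 0 = - \<i> * of_real x" by (simp add: \<zeta>_def complex_eq_iff)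
  have norm_\<zeta>: "norm (\<zeta> u) \<le> B" if "u \<in> {0..1}" for u
    using cmod_le[of "\<zeta> u"] that by (simp add: \<zeta> B_def)
  have cont_\<zeta>: "continuous_on S \<zeta>" for S
    unfolding \<zeta>_def[abs_def] complex_eq[symmetric] Complex_eq by (intro continuous_intros)
  have t_lim: "t \<longlonglongrightarrow> 0"
    unfolding t_def[abs_def] by (rule LIMSEQ_Suc[OF lim_1_over_n])
  have t: "0 < t n" "t n \<le> 1" "t n \<in> {0..1}" for n by (auto simp: t_def)
  \<comment> \<open>The partial sums converge uniformly on the closed segment, which makes the sum
    continuous at the endpoint on the imaginary axis.\<close>
  have "uniform_limit {0..1} (\<lambda>X u. \<Sum>k\<in>X. ?f k u) (\<lambda>u. \<Sum>\<^sub>\<infinity>k. ?f k u) (finite_subsets_at_top UNIV)"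
  proof (rule Weierstrass_m_test_general[where f = ?f and M = "\<lambda>k. B powr \<alpha> * majorant k"])
    show "(\<lambda>k. B powr \<alpha> * majorant k) summable_on UNIV"
      by (intro summable_on_cmult_right majorant_summable)
    show "norm (?f k u) \<le> B powr \<alpha> * majorant k" if "u \<in> {0..1}" for k u
    proof -
      have "norm (?f k u) \<le> norm (\<zeta> u) powr \<alpha> * majorant k"
        using that \<zeta>[of u] by (intro norm_term_le) auto
      also have "\<dots> \<le> B powr \<alpha> * majorant k"
        using norm_\<zeta>[OF that] \<alpha> by (intro mult_right_mono powr_mono2) (auto simp: majorant_def)
      finally show ?thesis .
    qed
  qed
  moreover have "continuous_on {0..1} (\<lambda>u. ?f k u)" for k
    by (intro continuous_on_mult continuous_on_const continuous_on_powr_complex cont_\<zeta>)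
       (use \<zeta> assms in auto)
  then have "continuous_on {0..1} (\<lambda>u. \<Sum>k\<in>X. ?f k u)" for X
    by (intro continuous_on_sum)
  ultimately have "continuous_on {0..1} (\<lambda>u. \<Sum>\<^sub>\<infinity>k. ?f k u)"
    by (intro uniform_limit_theorem[OF always_eventually]) auto
  then have "(\<lambda>n. \<Sum>\<^sub>\<infinity>k. ?f k (t n)) \<longlonglongrightarrow> (\<Sum>\<^sub>\<infinity>k. ?f k 0)"
    using t_lim t by (intro continuous_on_tendsto_compose[where f = "\<lambda>u. \<Sum>\<^sub>\<infinity>k. ?f k u"]) auto
  then have "(\<lambda>n. - (\<Sum>\<^sub>\<infinity>k. ?f k (t n))) \<longlonglongrightarrow> - (\<Sum>\<^sub>\<infinity>k. ?f k 0)" by (rule tendsto_minus)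
  moreover have "- (\<Sum>\<^sub>\<infinity>k. ?f k (t n)) = (\<integral>y. compensated (\<zeta> (t n)) y \<partial>\<phi>)" for n
    using compensated_right_half_plane(2)[of "\<zeta> (t n)"] t(1)[of n] by (simp add: \<zeta>)
  moreover have "(\<lambda>n. \<integral>y. compensated (\<zeta> (t n)) y \<partial>\<phi>) \<longlonglongrightarrow> (\<integral>y. compensated (\<zeta> 0) y \<partial>\<phi>)"
  proof (rule integral_dominated_convergence[where w = "\<lambda>y. 2 * (B + 2)\<^sup>2 * norm (compensated 1 y)"])
    show "integrable \<phi> (\<lambda>y. 2 * (B + 2)\<^sup>2 * norm (compensated 1 y))"
      using compensated_right_half_plane(1)[of 1] by (intro integrable_mult_right integrable_norm) auto
    show "AE y in \<phi>. norm (compensated (\<zeta> (t n)) y) \<le> 2 * (B + 2)\<^sup>2 * norm (compensated 1 y)" for n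
      using t[of n] \<zeta>[of "t n"] norm_\<zeta>[of "t n"]
      by (intro AE_I2 norm_compensated_le) (auto simp: space_levy)
    have "(\<lambda>n. \<zeta> (t n)) \<longlonglongrightarrow> \<zeta> 0"
      using t_lim cont_\<zeta>[of UNIV] by (intro continuous_on_tendsto_compose[where f = \<zeta>]) auto
    then show "AE y in \<phi>. (\<lambda>n. compensated (\<zeta> (t n)) y) \<longlonglongrightarrow> compensated (\<zeta> 0) y"
      unfolding compensated_def by (intro AE_I2 tendsto_intros)
  qed measurable
  ultimately have "(\<integral>y. compensated (\<zeta> 0) y \<partial>\<phi>) = - (\<Sum>\<^sub>\<infinity>k. ?f k 0)"
    by (simp only:) (rule LIMSEQ_unique)
  then show ?thesis by (simp add: log_char_eq_compensated \<zeta>0)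
qed

end

theorem theorem3p1:
  fixes c \<alpha> :: real and \<theta> :: "real \<Rightarrow> real" and \<phi> :: "real measure"
  assumes "c > 1" and "0 < \<alpha>" and "\<alpha> < 2" and "\<alpha> \<noteq> 1"
    and "smooth_admissible c \<alpha> \<theta>"
    and "is_levy_measure \<alpha> \<theta> \<phi>"
  shows "\<forall>x::real.
    (\<lambda>k::int. fourier_coeff (freq c \<alpha>) \<theta> k
        * Gamma (\<i> * of_int k * of_real (freq c \<alpha>) - of_real \<alpha> + 1)
        * (- \<i> * of_real x) powr (of_real \<alpha> - \<i> * of_int k * of_real (freq c \<alpha>)))
      summable_on UNIV \<and>
    log_char \<alpha> \<phi> x =
      - (\<Sum>\<^sub>\<infinity>k::int. fourier_coeff (freq c \<alpha>) \<theta> k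
          * Gamma (\<i> * of_int k * of_real (freq c \<alpha>) - of_real \<alpha> + 1)
          * (- \<i> * of_real x) powr (of_real \<alpha> - \<i> * of_int k * of_real (freq c \<alpha>)))"
proof (rule allI)
  fix x :: real
  interpret semistable c \<alpha> \<theta> \<phi>
    using assms by unfold_locales
  have s1: "\<i> * of_int k * of_real (freq c \<alpha>) - of_real \<alpha> + 1 = s k" for k
    by (simp add: s_def complex_eq_iff)
  have s2: "of_real \<alpha> - \<i> * of_int k * of_real (freq c \<alpha>) = 1 - s k" for k
    by (simp add: s_def complex_eq_iff)
  let ?f = "\<lambda>k. fcoeff k * Gamma (s k) * (- \<i> * of_real x) powr (1 - s k)"
  have "?f summable_on UNIV \<and> log_char \<alpha> \<phi> x = - (\<Sum>\<^sub>\<infinity>k. ?f k)"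
  proof (cases "x = 0")
    \<comment> \<open>Here the integrand is 0, and so is every term of the series, because
      \<open>0 powr z\<close> is 0. This agrees with the convention of the statement, as the
      exponents have real part \<alpha> > 0.\<close>
    case True
    then show ?thesis by (simp add: log_char_def)
  next
    case False
    then have "?f summable_on UNIV"
      by (intro abs_summable_summable[OF term_abs_summable]) auto
    then show ?thesis using log_char_series[OF False] by simp
  qed
  then show "(\<lambda>k::int. fourier_coeff (freq c \<alpha>) \<theta> k
        * Gamma (\<i> * of_int k * of_real (freq c \<alpha>) - of_real \<alpha> + 1)
        * (- \<i> * of_real x) powr (of_real \<alpha> - \<i> * of_int k * of_real (freq c \<alpha>)))
      summable_on UNIV \<and>
    log_char \<alpha> \<phi> x =
      - (\<Sum>\<^sub>\<infinity>k::int. fourier_coeff (freq c \<alpha>) \<theta> k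
          * Gamma (\<i> * of_int k * of_real (freq c \<alpha>) - of_real \<alpha> + 1)
          * (- \<i> * of_real x) powr (of_real \<alpha> - \<i> * of_int k * of_real (freq c \<alpha>)))"
    unfolding s1 s2 fcoeff_def .
qed

end
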